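(* Let $\mathcal{M}$ be an $n$-dimensional paracompact smooth manifold with a linear symmetric (torsion-free) connection $\Gamma$, let $\gamma$ be a symplectic connection on $(\mathcal{T}^*\mathcal{M},\omega)$ compatible with $\Gamma$, and let $*$ be the Fedosov star product generated by $\gamma$. If $a_0,b_0$ are smooth functions depending only on the spatial coordinates $q^1,\dots,q^n$ of a proper Darboux chart, then their $*$-product is the pointwise product: $a_0*b_0=a_0\cdot b_0$.
   Context: All objects are smooth; repeated indices are summed. Local coordinates $q^1,\dots,q^n$ on $\mathcal{M}$ induce coordinates $(q^1,\dots,q^n,p_1,\dots,p_n)=(x^1,\dots,x^{2n})$ on $\mathcal{W}=\mathcal{T}^*\mathcal{M}$, where a covector is $p_i dq^i$; such a chart is called a proper Darboux chart. The symplectic form is $\omega=dq^i\wedge dp_i=\tfrac12\omega_{ij}dx^i\wedge dx^j$, and $\omega^{ij}$ is defined by $\omega_{kl}\omega^{lj}=\delta^j_k$. Greek indices run over $1,\dots,n$, capital Latin indices over $n+1,\dots,2n$, lower case Latin over $1,\dots,2n$. A symplectic connection $\gamma$ is a torsion-free linear connection on $\mathcal{W}$ with $\nabla\omega=0$; put $\gamma_{ijk}:=\omega_{il}\gamma^l_{jk}$ (totally symmetric in Darboux coordinates). $\gamma$ is compatible with $\Gamma$ if in every proper Darboux chart: $\gamma_{IJK}=0$; $\gamma_{IJ\alpha}=0$; $\gamma_{I\alpha\beta}(q,p)=-\Gamma^{I-n}_{\alpha\beta}(q)$; and $\gamma_{\alpha\beta\delta}(q,p)=p_\varepsilon f^{\varepsilon}_{\alpha\beta\delta}(q)$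 with smooth $f^\varepsilon_{\alpha\beta\delta}$ depending on $q$ only. Fedosov formalism. The Weyl bundle has as sections formal series $a=\sum_{k,l\ge0}\hbar^k a_{k,j_1\dots j_l}y^{j_1}\cdots y^{j_l}$, where $a_{k,j_1\dots j_l}$ are components of smooth totally symmetric covariant tensor fields on $\mathcal{W}$ and $y^1,\dots,y^{2n}$ are formal commuting variables (components of a tangent vector). A term $\hbar^k$ times a monomial with $l$ factors $y$ has degree $2k+l$. The product is $$a\circ b=\sum_{t\ge0}\frac1{t!}\Big(-\frac{i\hbar}2\Big)^t\omega^{i_1j_1}\cdots\omega^{i_tj_t}\frac{\partial^ta}{\partial y^{i_1}\cdots\partial y^{i_t}}\frac{\partial^tb}{\partial y^{j_1}\cdots\partial y^{j_t}},$$ extended to differential forms with values in the Weyl bundle using the wedge product of forms; $[a,b]=a\circ b-(-1)^{m_1m_2}b\circ a$ for an $m_1$-form $a$ and $m_2$-form $b$. Put $\delta a=dx^k\wedge\frac{\partial a}{\partial y^k}$; on an $m$-form homogeneous of degree $l$ in the $y$'s, $\delta^{-1}a=\frac1{l+m}y^k\,\frac{\partial}{\partial x^k}\rfloor a$ if $l+m>0$ and $\delta^{-1}a=0$ if $l+m=0$. In a Darboux chart $\gamma$ also denotes the $1$-form $\frac12\gamma_{ijk}y^iy^jdx^k$; $\partial_\gamma a=da+\frac i\hbar[\gamma,a]$ and $R_\gamma=d\gamma+\frac i\hbar\gamma\circ\gamma$. The Abelian connection series $r$ generated by $\gamma$ is the unique $1$-form with values in the Weyl bundle satisfying $\delta r=R_\gamma+\partial_\gamma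 r+\frac i\hbar r\circ r$, $\delta^{-1}r=0$ and having only terms of degree $\ge3$. The Abelian connection is $\tilde\gamma=\omega_{ij}y^idx^j+\gamma+r$, and a section $a$ of the Weyl bundle is flat if $\partial_{\tilde\gamma}a=da+\frac i\hbar[\tilde\gamma,a]=0$. For every smooth function $a_0$ there is a unique flat section $a=:\sigma^{-1}(a_0)$ with $\sigma(a):=a|_{y=0}=a_0$; it is the unique solution of $a=a_0+\delta^{-1}\big(\partial_\gamma a+\frac i\hbar[r,a]\big)$. The Fedosov star product generated by $\gamma$ is $a_0*b_0:=\sigma\big(\sigma^{-1}(a_0)\circ\sigma^{-1}(b_0)\big)$. *)

theory Defs
  imports
    "HOL-Analysis.Analysis"
    "HOL-Computational_Algebra.Formal_Power_Series"
    "HOL-Combinatorics.Permutations"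
    "HOL-Library.Function_Algebras"
begin

section \<open>Smooth functions on open subsets of Euclidean space\<close>

definition partial :: "'k::finite \<Rightarrow> (real^'k \<Rightarrow> 'b::real_normed_vector) \<Rightarrow> real^'k \<Rightarrow> 'b" where
  "partial i f x = frechet_derivative f (at x) (axis i 1)"

text \<open>Meant for open \<open>S\<close>.\<close>

fun Ck_on :: "nat \<Rightarrow> (real^'k) set \<Rightarrow> (real^'k::finite \<Rightarrow> 'b::real_normed_vector) \<Rightarrow> bool" where
  "Ck_on 0 S f \<longleftrightarrow> continuous_on S f"
| "Ck_on (Suc m) S f \<longleftrightarrow>
     (\<forall>x\<in>S. f differentiable (at x)) \<and> (\<forall>i. Ck_on m S (partial i f))"

definition smooth_on :: "(real^'k) set \<Rightarrow> (real^'k::finite \<Rightarrow> 'b::real_normed_vector) \<Rightarrow> bool" where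
  "smooth_on S f \<longleftrightarrow> (\<forall>m. Ck_on m S f)"


section \<open>Manifolds\<close>

text \<open>A chart is a pair of its domain and its coordinate map; the values of the map outside the
  domain are irrelevant.\<close>

type_synonym ('p, 'k) chart = "'p set \<times> ('p \<Rightarrow> (real, 'k) vec)"

definition chart_image :: "('p, 'k::finite) chart \<Rightarrow> (real^'k) set" where
  "chart_image c = snd c ` fst c"

definition chart_inv :: "('p, 'k::finite) chart \<Rightarrow> real^'k \<Rightarrow> 'p" where
  "chart_inv c = inv_into (fst c) (snd c)"

definition transition :: "('p, 'k::finite) chart \<Rightarrow> ('p, 'k) chart \<Rightarrow> real^'k \<Rightarrow> real^'k" where
  "transition c c' = snd c' \<circ> chart_inv c"

text \<open>With \<open>x\<close> the coordinates of \<open>c\<close> and \<open>x'\<close> those of \<open>c'\<close>, \<open>jac c c' w i j\<close> is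
  \<open>\<partial>x'\<^sup>i/\<partial>x\<^sup>j\<close> and \<open>hess c c' w i j k\<close> is \<open>\<partial>\<^sup>2x'\<^sup>i/\<partial>x\<^sup>j\<partial>x\<^sup>k\<close>, both at the point \<open>w\<close>.\<close>

definition jac :: "('p, 'k::finite) chart \<Rightarrow> ('p, 'k) chart \<Rightarrow> 'p \<Rightarrow> 'k \<Rightarrow> 'k \<Rightarrow> real" where
  "jac c c' w i j = partial j (\<lambda>x. transition c c' x $ i) (snd c w)"

definition hess :: "('p, 'k::finite) chart \<Rightarrow> ('p, 'k) chart \<Rightarrow> 'p \<Rightarrow> 'k \<Rightarrow> 'k \<Rightarrow> 'k \<Rightarrow> real" where
  "hess c c' w i j k = partial k (partial j (\<lambda>x. transition c c' x $ i)) (snd c w)"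

definition is_chart :: "'m topology \<Rightarrow> ('m, 'n::finite) chart \<Rightarrow> bool" where
  "is_chart X c \<longleftrightarrow> openin X (fst c) \<and> open (chart_image c) \<and>
     homeomorphic_map (subtopology X (fst c)) (top_of_set (chart_image c)) (snd c)"

definition smoothly_compatible :: "('m, 'n::finite) chart \<Rightarrow> ('m, 'n) chart \<Rightarrow> bool" where
  "smoothly_compatible c c' \<longleftrightarrow>
     smooth_on (snd c ` (fst c \<inter> fst c')) (transition c c') \<and>
     smooth_on (snd c' ` (fst c \<inter> fst c')) (transition c' c)"

definition paracompact_space :: "'m topology \<Rightarrow> bool" where
  "paracompact_space X \<longleftrightarrow>
     (\<forall>\<U>. (\<forall>U\<in>\<U>. openin X U) \<and> \<Union>\<U> = topspace X \<longrightarrow>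
        (\<exists>\<V>. (\<forall>V\<in>\<V>. openin X V \<and> (\<exists>U\<in>\<U>. V \<subseteq> U)) \<and> \<Union>\<V> = topspace X \<and>
             locally_finite_in X \<V>))"

text \<open>\<open>A\<close> is the maximal atlas; the dimension is \<open>CARD('n)\<close>.\<close>

definition smooth_manifold :: "'m topology \<Rightarrow> ('m, 'n::finite) chart set \<Rightarrow> bool" where
  "smooth_manifold X A \<longleftrightarrow>
     Hausdorff_space X \<and> paracompact_space X \<and>
     (\<Union>c\<in>A. fst c) = topspace X \<and>
     (\<forall>c\<in>A. is_chart X c) \<and>
     (\<forall>c\<in>A. \<forall>c'\<in>A. smoothly_compatible c c') \<and>
     (\<forall>c. is_chart X c \<and> (\<forall>c'\<in>A. smoothly_compatible c c') \<longrightarrow> c \<in> A)"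

definition smooth_function :: "('p, 'k::finite) chart set \<Rightarrow> ('p \<Rightarrow> complex) \<Rightarrow> bool" where
  "smooth_function P f \<longleftrightarrow> (\<forall>c\<in>P. smooth_on (chart_image c) (f \<circ> chart_inv c))"


section \<open>Linear connections\<close>

text \<open>A linear connection is the family of its coefficients, \<open>G c x i j k\<close> being the coefficient
  with upper index \<open>i\<close> and lower indices \<open>j k\<close> in the chart \<open>c\<close> at the point with coordinates
  \<open>x\<close>.\<close>

type_synonym ('p, 'k) connection = "('p, 'k) chart \<Rightarrow> (real, 'k) vec \<Rightarrow> 'k \<Rightarrow> 'k \<Rightarrow> 'k \<Rightarrow> real"

definition linear_connection :: "('p, 'k::finite) chart set \<Rightarrow> ('p, 'k) connection \<Rightarrow> bool" where
  "linear_connection P G \<longleftrightarrow>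
     (\<forall>c\<in>P. \<forall>i j k. smooth_on (chart_image c) (\<lambda>x. G c x i j k)) \<and>
     (\<forall>c\<in>P. \<forall>c'\<in>P. \<forall>w\<in>fst c \<inter> fst c'. \<forall>i j k.
        G c' (snd c' w) i j k =
          (\<Sum>a\<in>UNIV. jac c c' w i a *
             (hess c' c w a j k +
              (\<Sum>b\<in>UNIV. \<Sum>d\<in>UNIV. G c (snd c w) a b d * jac c' c w b j * jac c' c w d k))))"

definition torsion_free :: "('p, 'k::finite) chart set \<Rightarrow> ('p, 'k) connection \<Rightarrow> bool" where
  "torsion_free P G \<longleftrightarrow> (\<forall>c\<in>P. \<forall>x\<in>chart_image c. \<forall>i j k. G c x i j k = G c x i k j)"


section \<open>The cotangent bundle and its symplectic structure\<close>

text \<open>A covector at \<open>x\<close> is the family of its components in all charts around \<open>x\<close>, related by the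
  covariant transformation law (and set to \<open>0\<close> for all other charts).\<close>

definition cotangent_space ::
  "('m, 'n::finite) chart set \<Rightarrow> 'm \<Rightarrow> (('m, 'n) chart \<Rightarrow> real^'n) set" where
  "cotangent_space A x =
     {\<xi>. (\<forall>c. \<not> (c \<in> A \<and> x \<in> fst c) \<longrightarrow> \<xi> c = 0) \<and>
         (\<forall>c\<in>A. \<forall>c'\<in>A. x \<in> fst c \<inter> fst c' \<longrightarrow>
            (\<forall>\<beta>. \<xi> c' $ \<beta> = (\<Sum>\<alpha>\<in>UNIV. jac c' c x \<alpha> \<beta> * \<xi> c $ \<alpha>)))}"

type_synonym ('m, 'n) cotangent_point = "'m \<times> (('m, 'n) chart \<Rightarrow> (real, 'n) vec)"

text \<open>Coordinates on the cotangent bundle are indexed by \<open>'n + 'n\<close>: \<open>Inl \<alpha>\<close> is the index of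
  \<open>q\<^sup>\<alpha>\<close> (Greek indices), \<open>Inr \<alpha>\<close> that of \<open>p\<^sub>\<alpha>\<close> (capital Latin indices, \<open>I = n + \<alpha>\<close>).\<close>

definition darboux_chart ::
  "('m, 'n::finite) chart set \<Rightarrow> ('m, 'n) chart \<Rightarrow> (('m, 'n) cotangent_point, 'n + 'n) chart" where
  "darboux_chart A c =
     ({(x, \<xi>). x \<in> fst c \<and> \<xi> \<in> cotangent_space A x},
      \<lambda>(x, \<xi>). \<chi> i. case i of Inl \<alpha> \<Rightarrow> snd c x $ \<alpha> | Inr \<alpha> \<Rightarrow> \<xi> c $ \<alpha>)"

text \<open>The proper Darboux charts with base in the open set \<open>V\<close>. Since the atlas is maximal, they
  form an atlas of the cotangent bundle of \<open>V\<close>.\<close>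

definition darboux_atlas ::
  "('m, 'n::finite) chart set \<Rightarrow> 'm set \<Rightarrow> (('m, 'n) cotangent_point, 'n + 'n) chart set" where
  "darboux_atlas A V = darboux_chart A ` {c\<in>A. fst c \<subseteq> V}"

definition q_part :: "real^('n + 'n) \<Rightarrow> real^'n::finite" where
  "q_part x = (\<chi> \<alpha>. x $ Inl \<alpha>)"

text \<open>The matrix \<open>\<omega>\<^sub>i\<^sub>j\<close> of \<open>dq\<^sup>\<alpha> \<and> dp\<^sub>\<alpha>\<close> in any proper Darboux chart, and the matrix
  \<open>\<omega>\<^sup>i\<^sup>j\<close> inverse to it.\<close>

definition omega :: "real^('n + 'n)^('n::finite + 'n)" where
  "omega = (\<chi> i j. case (i, j) of
     (Inl \<alpha>, Inr \<beta>) \<Rightarrow> (if \<alpha> = \<beta> then 1 else 0)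
   | (Inr \<alpha>, Inl \<beta>) \<Rightarrow> (if \<alpha> = \<beta> then -1 else 0)
   | _ \<Rightarrow> 0)"

definition omega_inv :: "real^('n + 'n)^('n::finite + 'n)" where
  "omega_inv = matrix_inv omega"

definition symplectic_connection ::
  "('p, 'n::finite + 'n) chart set \<Rightarrow> ('p, 'n + 'n) connection \<Rightarrow> bool" where
  "symplectic_connection P \<gamma> \<longleftrightarrow>
     linear_connection P \<gamma> \<and> torsion_free P \<gamma> \<and>
     (\<forall>c\<in>P. \<forall>x\<in>chart_image c. \<forall>i j k.
        partial k (\<lambda>_. omega $ i $ j) x
          - (\<Sum>l\<in>UNIV. \<gamma> c x l i k * omega $ l $ j)
          - (\<Sum>l\<in>UNIV. \<gamma> c x l j k * omega $ i $ l) = 0)"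

text \<open>\<open>\<gamma>\<^sub>i\<^sub>j\<^sub>k = \<omega>\<^sub>i\<^sub>l \<gamma>\<^sup>l\<^sub>j\<^sub>k\<close>, in one fixed chart.\<close>

definition lower ::
  "(real^('n + 'n) \<Rightarrow> 'n + 'n \<Rightarrow> 'n + 'n \<Rightarrow> 'n + 'n \<Rightarrow> real) \<Rightarrow>
   real^('n + 'n) \<Rightarrow> 'n + 'n \<Rightarrow> 'n + 'n \<Rightarrow> 'n::finite + 'n \<Rightarrow> real" where
  "lower g x i j k = (\<Sum>l\<in>UNIV. omega $ i $ l * g x l j k)"

definition compatible_connection ::
  "('m, 'n::finite) chart set \<Rightarrow> ('m, 'n) connection \<Rightarrow>
   (('m, 'n) cotangent_point, 'n + 'n) connection \<Rightarrow> bool" where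
  "compatible_connection A \<Gamma> \<gamma> \<longleftrightarrow>
     (\<forall>c\<in>A. let D = chart_image (darboux_chart A c); g = lower (\<gamma> (darboux_chart A c)) in
        (\<forall>x\<in>D. \<forall>i j k. g x (Inr i) (Inr j) (Inr k) = 0) \<and>
        (\<forall>x\<in>D. \<forall>i j \<alpha>. g x (Inr i) (Inr j) (Inl \<alpha>) = 0) \<and>
        (\<forall>x\<in>D. \<forall>i \<alpha> \<beta>. g x (Inr i) (Inl \<alpha>) (Inl \<beta>) = - \<Gamma> c (q_part x) i \<alpha> \<beta>) \<and>
        (\<exists>f. (\<forall>\<epsilon> \<alpha> \<beta> \<delta>. smooth_on (chart_image c) (f \<epsilon> \<alpha> \<beta> \<delta>)) \<and>
             (\<forall>x\<in>D. \<forall>\<alpha> \<beta> \<delta>. g x (Inl \<alpha>) (Inl \<beta>) (Inl \<delta>) =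
                (\<Sum>\<epsilon>\<in>UNIV. x $ Inr \<epsilon> * f \<epsilon> \<alpha> \<beta> \<delta> (q_part x)))))"


section \<open>The Weyl algebra\<close>

text \<open>A formal series in \<open>\<hbar>\<close> and the \<open>y\<^sup>i\<close> is given by the coefficients in \<open>\<complex>[[\<hbar>]]\<close> of the
  monomials in \<open>y\<close>, a monomial being the multiset of its factors.\<close>

type_synonym 'k weyl = "'k multiset \<Rightarrow> complex fps"

abbreviation hbar :: "complex fps" where "hbar \<equiv> fps_X"

text \<open>The commutative product of formal series.\<close>

definition y_mult :: "'k weyl \<Rightarrow> 'k weyl \<Rightarrow> 'k weyl" where
  "y_mult a b = (\<lambda>M. \<Sum>N | N \<subseteq># M. a N * b (M - N))"

definition y_deriv :: "'k \<Rightarrow> 'k weyl \<Rightarrow> 'k weyl" where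
  "y_deriv i a = (\<lambda>M. of_nat (Suc (count M i)) * a (add_mset i M))"

definition y_derivs :: "'k list \<Rightarrow> 'k weyl \<Rightarrow> 'k weyl" where
  "y_derivs I a = foldr y_deriv I a"

definition weyl_term :: "nat \<Rightarrow> ('n::finite + 'n) weyl \<Rightarrow> ('n + 'n) weyl \<Rightarrow> ('n + 'n) weyl" where
  "weyl_term t a b = (\<lambda>M. fps_const (1 / fact t) * (fps_const (- \<i> / 2) * hbar) ^ t *
     (\<Sum>I | length I = t. \<Sum>J | length J = t.
        fps_const (of_real (\<Prod>s<t. omega_inv $ (I ! s) $ (J ! s))) *
        y_mult (y_derivs I a) (y_derivs J b) M))"

text \<open>The term with index \<open>t\<close> is divisible by \<open>\<hbar>\<^sup>t\<close>, so only \<open>t \<le> h\<close> contributes to the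
  coefficient of \<open>\<hbar>\<^sup>h\<close> in the infinite sum.\<close>

definition weyl_mult :: "('n::finite + 'n) weyl \<Rightarrow> ('n + 'n) weyl \<Rightarrow> ('n + 'n) weyl" where
  "weyl_mult a b = (\<lambda>M. Abs_fps (\<lambda>h. \<Sum>t\<le>h. fps_nth (weyl_term t a b M) h))"


section \<open>Forms with values in the Weyl bundle\<close>

text \<open>An \<open>m\<close>-form at a point is
  \<open>(1/m!) a\<^bsub>k\<^sub>1\<dots>k\<^sub>m\<^esub> dx\<^bsup>k\<^sub>1\<^esup> \<and> \<dots> \<and> dx\<^bsup>k\<^sub>m\<^esup>\<close>
  with alternating components, represented as a function of the index list that
  vanishes on lists of length other than \<open>m\<close>.\<close>

type_synonym 'k wform = "'k list \<Rightarrow> 'k weyl"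

definition drop_nth :: "nat \<Rightarrow> 'a list \<Rightarrow> 'a list" where
  "drop_nth s K = take s K @ drop (Suc s) K"

text \<open>Wedge product of forms combined with the Weyl product of values: the sum runs over the sets
  \<open>S\<close> of positions assigned to \<open>a\<close>, with the sign of the corresponding shuffle.\<close>

definition circ :: "('n::finite + 'n) wform \<Rightarrow> ('n + 'n) wform \<Rightarrow> ('n + 'n) wform" where
  "circ a b = (\<lambda>K M. \<Sum>S\<in>Pow {..<length K}.
     (-1) ^ card {(s, t). s < t \<and> t \<in> S \<and> s \<notin> S} *
     weyl_mult (a (nths K S)) (b (nths K (- S))) M)"

definition wcomm ::
  "nat \<Rightarrow> nat \<Rightarrow> ('n::finite + 'n) wform \<Rightarrow> ('n + 'n) wform \<Rightarrow> ('n + 'n) wform" where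
  "wcomm m1 m2 a b = (\<lambda>K M. circ a b K M - (-1) ^ (m1 * m2) * circ b a K M)"

text \<open>Multiplication by \<open>\<i>/\<hbar>\<close>. It is only applied to commutators and to squares of 1-forms, where
  the coefficient of \<open>\<hbar>\<^sup>0\<close>, which \<open>fps_shift\<close> discards, vanishes.\<close>

definition i_over_hbar :: "'k wform \<Rightarrow> 'k wform" where
  "i_over_hbar a = (\<lambda>K M. fps_const \<i> * fps_shift 1 (a K M))"

definition delta :: "'k wform \<Rightarrow> 'k wform" where
  "delta a = (\<lambda>K M. \<Sum>s<length K. (-1) ^ s * y_deriv (K ! s) (a (drop_nth s K)) M)"

text \<open>The coefficient of \<open>y\<^sup>M\<close> in component \<open>K\<close> of \<open>y\<^sup>k \<partial>\<^sub>k\<rfloor>a\<close> comes from the part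
  of \<open>a\<close> of form degree \<open>length K + 1\<close> and \<open>y\<close>-degree \<open>size M - 1\<close>, so \<open>l + m\<close> is
  \<open>size M + length K\<close>; for \<open>M\<close> empty the sum is empty.\<close>

definition delta_inv :: "'k wform \<Rightarrow> 'k wform" where
  "delta_inv a = (\<lambda>K M. fps_const (1 / of_nat (size M + length K)) *
     (\<Sum>k\<in>set_mset M. a (k # K) (M - {#k#})))"

text \<open>The exterior derivative of a form in a coordinate domain; \<open>\<hbar>\<close> and \<open>y\<close> are constants.\<close>

definition ext_d :: "(real^'k \<Rightarrow> 'k wform) \<Rightarrow> real^'k \<Rightarrow> 'k::finite wform" where
  "ext_d a x = (\<lambda>K M. Abs_fps (\<lambda>h. \<Sum>s<length K.
     (-1) ^ s * partial (K ! s) (\<lambda>z. fps_nth (a z (drop_nth s K) M) h) x))"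

text \<open>The 1-forms \<open>\<omega>\<^sub>i\<^sub>j y\<^sup>i dx\<^sup>j\<close> and \<open>\<onehalf>\<gamma>\<^sub>i\<^sub>j\<^sub>k y\<^sup>i y\<^sup>j dx\<^sup>k\<close>; the argument of
  \<open>gamma_form\<close> is \<open>\<gamma>\<^sup>i\<^sub>j\<^sub>k\<close>.\<close>

definition omega_form :: "('n::finite + 'n) wform" where
  "omega_form = (\<lambda>K M. case K of
     [j] \<Rightarrow> fps_const (of_real (\<Sum>i\<in>UNIV. if M = {#i#} then omega $ i $ j else 0))
   | _ \<Rightarrow> 0)"

definition gamma_form ::
  "(real^('n + 'n) \<Rightarrow> 'n + 'n \<Rightarrow> 'n + 'n \<Rightarrow> 'n + 'n \<Rightarrow> real) \<Rightarrow>
   real^('n + 'n) \<Rightarrow> ('n::finite + 'n) wform" where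
  "gamma_form g x = (\<lambda>K M. case K of
     [k] \<Rightarrow> fps_const (of_real
              (\<Sum>i\<in>UNIV. \<Sum>j\<in>UNIV. if M = {#i, j#} then lower g x i j k / 2 else 0))
   | _ \<Rightarrow> 0)"

text \<open>\<open>da + (\<i>/\<hbar>)[\<theta>, a]\<close> for a 1-form \<open>\<theta>\<close> and an \<open>m\<close>-form \<open>a\<close>.\<close>

definition cov_d ::
  "nat \<Rightarrow> (real^('n + 'n) \<Rightarrow> ('n + 'n) wform) \<Rightarrow> (real^('n + 'n) \<Rightarrow> ('n + 'n) wform) \<Rightarrow>
   real^('n + 'n) \<Rightarrow> ('n::finite + 'n) wform" where
  "cov_d m \<theta> a x = ext_d a x + i_over_hbar (wcomm 1 m (\<theta> x) (a x))"

definition curvature_form ::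
  "(real^('n + 'n) \<Rightarrow> ('n + 'n) wform) \<Rightarrow> real^('n + 'n) \<Rightarrow> ('n::finite + 'n) wform" where
  "curvature_form \<theta> x = ext_d \<theta> x + i_over_hbar (circ (\<theta> x) (\<theta> x))"


section \<open>Sections of the Weyl bundle\<close>

text \<open>The component with indices \<open>J\<close> of the symmetric tensor belonging to a formal series in \<open>y\<close>:
  in \<open>a\<^bsub>j\<^sub>1\<dots>j\<^sub>l\<^esub> y\<^bsup>j\<^sub>1\<^esup> \<dots> y\<^bsup>j\<^sub>l\<^esup>\<close> all rearrangements of \<open>J\<close>
  contribute to the same monomial.\<close>

definition tensor_comp :: "'k weyl \<Rightarrow> 'k list \<Rightarrow> complex fps" where
  "tensor_comp a J = fps_const (1 / of_nat (card {I. mset I = mset J})) * a (mset J)"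

text \<open>Smooth \<open>m\<close>-forms with values in the Weyl bundle, as families of components in the charts
  of \<open>P\<close>.\<close>

definition weyl_section ::
  "('p, 'k::finite) chart set \<Rightarrow> nat \<Rightarrow> (('p, 'k) chart \<Rightarrow> real^'k \<Rightarrow> 'k wform) \<Rightarrow> bool" where
  "weyl_section P m a \<longleftrightarrow>
     (\<forall>c\<in>P. \<forall>K M h. smooth_on (chart_image c) (\<lambda>x. fps_nth (a c x K M) h)) \<and>
     (\<forall>c\<in>P. \<forall>x\<in>chart_image c. \<forall>K M. length K \<noteq> m \<longrightarrow> a c x K M = 0) \<and>
     (\<forall>c\<in>P. \<forall>x\<in>chart_image c. \<forall>K M \<pi>. length K = m \<longrightarrow> \<pi> permutes {..<m} \<longrightarrow>
        a c x (permute_list \<pi> K) M = of_int (sign \<pi>) * a c x K M) \<and>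
     (\<forall>c\<in>P. \<forall>c'\<in>P. \<forall>w\<in>fst c \<inter> fst c'. \<forall>J K. length K = m \<longrightarrow>
        tensor_comp (a c' (snd c' w) K) J =
          (\<Sum>I | length I = length J. \<Sum>L | length L = m.
             fps_const (of_real ((\<Prod>s<length J. jac c' c w (I ! s) (J ! s)) *
                                 (\<Prod>s<m. jac c' c w (L ! s) (K ! s)))) *
             tensor_comp (a c (snd c w) L) I))"


section \<open>The Fedosov star product\<close>

definition abelian_connection_series ::
  "('p, 'n + 'n) chart set \<Rightarrow> ('p, 'n + 'n) connection \<Rightarrow>
   (('p, 'n + 'n) chart \<Rightarrow> real^('n + 'n) \<Rightarrow> ('n::finite + 'n) wform) \<Rightarrow> bool" where
  "abelian_connection_series P \<gamma> r \<longleftrightarrow>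
     weyl_section P 1 r \<and>
     (\<forall>c\<in>P. \<forall>x\<in>chart_image c.
        delta (r c x) =
          curvature_form (gamma_form (\<gamma> c)) x + cov_d 1 (gamma_form (\<gamma> c)) (r c) x
          + i_over_hbar (circ (r c x) (r c x)) \<and>
        delta_inv (r c x) = 0 \<and>
        (\<forall>K M h. fps_nth (r c x K M) h \<noteq> 0 \<longrightarrow> 3 \<le> 2 * h + size M))"

text \<open>\<open>a\<close> is the flat section with \<open>\<sigma>(a) = a0\<close>, that is \<open>a = \<sigma>\<^sup>-\<^sup>1(a0)\<close>.\<close>

definition flat_lift ::
  "('p, 'n + 'n) chart set \<Rightarrow> ('p, 'n + 'n) connection \<Rightarrow>
   (('p, 'n + 'n) chart \<Rightarrow> real^('n + 'n) \<Rightarrow> ('n + 'n) wform) \<Rightarrow> ('p \<Rightarrow> complex) \<Rightarrow>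
   (('p, 'n + 'n) chart \<Rightarrow> real^('n + 'n) \<Rightarrow> ('n::finite + 'n) wform) \<Rightarrow> bool" where
  "flat_lift P \<gamma> r a0 a \<longleftrightarrow>
     weyl_section P 0 a \<and>
     (\<forall>c\<in>P. \<forall>x\<in>chart_image c.
        cov_d 0 (\<lambda>z. omega_form + gamma_form (\<gamma> c) z + r c z) (a c) x = 0 \<and>
        a c x [] {#} = fps_const (a0 (chart_inv c x)))"

text \<open>\<open>star\<close> is the Fedosov star product generated by \<open>\<gamma>\<close>. The series \<open>r\<close> and the lifts exist and
  are unique on the chart images, so that this determines \<open>star a0 b0\<close> on the domains of the
  charts in \<open>P\<close>.\<close>

definition fedosov_star_product ::
  "('p, 'n::finite + 'n) chart set \<Rightarrow> ('p, 'n + 'n) connection \<Rightarrow>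
   (('p \<Rightarrow> complex) \<Rightarrow> ('p \<Rightarrow> complex) \<Rightarrow> 'p \<Rightarrow> complex fps) \<Rightarrow> bool" where
  "fedosov_star_product P \<gamma> star \<longleftrightarrow>
     (\<exists>r. abelian_connection_series P \<gamma> r \<and>
        (\<forall>a0 b0. smooth_function P a0 \<and> smooth_function P b0 \<longrightarrow>
           (\<exists>a b. flat_lift P \<gamma> r a0 a \<and> flat_lift P \<gamma> r b0 b \<and>
              (\<forall>c\<in>P. \<forall>w\<in>fst c.
                 star a0 b0 w = circ (a c (snd c w)) (b c (snd c w)) [] {#}))))"

definition depends_only_on_q ::
  "('p, 'n::finite + 'n) chart \<Rightarrow> ('p \<Rightarrow> complex) \<Rightarrow> bool" where
  "depends_only_on_q c f \<longleftrightarrow>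
     (\<forall>w\<in>fst c. \<forall>w'\<in>fst c. q_part (snd c w) = q_part (snd c w') \<longrightarrow> f w = f w')"

end

(* Give p, the y's in momentum directions, dp and hbar the weight 1 and everything else the weight 0.
   The Weyl product preserves the weight, since each factor hbar comes with a contraction by
   omega^ij, which removes one momentum direction. Compatibility of gamma with a connection on the
   base gives gamma the weight 1, hence by induction on the degree 2k + l so has r, and the
   flat lift of a function of q alone has weight 0. Such a lift is a power series in the
   positional y's with coefficients depending on q only; as omega^ij has no positional block, two
   such series multiply pointwise. *)

theory Submission
  imports Defs
begin

section \<open>Functions that are polynomial along the fibres\<close>

text \<open>Every bracket in the equations for r and for the lift is multiplied by i/hbar, which
  costs one unit of weight and two of degree. The weights 1 and 0 are the values that survive this:
  1 + 1 - 1 = 1 for brackets and squares of gamma and r, and 1 + 0 - 1 = 0 for their action on a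
  lift. The loss of degree is made good because gamma has degree 2 and r at least 3, so that the
  unknown factors of a bracket stay within reach of the induction hypothesis, and inverting delta
  gains one degree. The exterior derivative keeps the weight because dx^k carries exactly what
  differentiation by x^k takes from the degree in p. The delicate point is the derivatives in the q
  directions: the induction yields polynomials fibre by fibre and says nothing about how their
  coefficients vary with q. Hence the description of polynomials by finite differences. These need
  fibres that are whole vector spaces, and so the image of a proper Darboux chart has to be shown to
  contain every momentum over the base chart.\<close>

text \<open>Polynomials of degree less than \<open>n\<close> in the sense of vanishing finite differences. No
  regularity is involved, so that the condition passes to pointwise limits and hence to partial
  derivatives, also those in directions transversal to the fibres.\<close>

fun polydiff :: "nat \<Rightarrow> ('v::ab_group_add \<Rightarrow> complex) \<Rightarrow> bool" where
  "polydiff 0 f \<longleftrightarrow> (\<forall>p. f p = 0)"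
| "polydiff (Suc n) f \<longleftrightarrow> (\<forall>v. polydiff n (\<lambda>p. f (p + v) - f p))"

lemma polydiff_zero: "polydiff n (\<lambda>p. 0)"
  by (induction n) auto

lemma polydiff_add: "polydiff n f \<Longrightarrow> polydiff n g \<Longrightarrow> polydiff n (\<lambda>p. f p + g p)"
proof (induction n arbitrary: f g)
  case (Suc n)
  show ?case
  proof (simp only: polydiff.simps, intro allI)
    fix v
    have "polydiff n (\<lambda>p. (f (p + v) - f p) + (g (p + v) - g p))"
      using Suc by auto
    then show "polydiff n (\<lambda>p. f (p + v) + g (p + v) - (f p + g p))"
      by (simp add: algebra_simps)
  qed
qed auto

lemma polydiff_cmult: "polydiff n f \<Longrightarrow> polydiff n (\<lambda>p. c * f p)"
  by (induction n arbitrary: f) (auto simp flip: right_diff_distrib)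

lemma polydiff_sum: "(\<And>i. i \<in> S \<Longrightarrow> polydiff n (f i)) \<Longrightarrow> polydiff n (\<lambda>p. \<Sum>i\<in>S. f i p)"
  by (induction S rule: infinite_finite_induct) (auto intro: polydiff_zero polydiff_add)

lemma polydiff_shift: "polydiff n f \<Longrightarrow> polydiff n (\<lambda>p. f (p + v))"
proof (induction n arbitrary: f)
  case (Suc n)
  show ?case
  proof (simp only: polydiff.simps, intro allI)
    fix u
    have "polydiff n (\<lambda>p. (\<lambda>p. f (p + u) - f p) (p + v))"
      using Suc by fastforce
    then show "polydiff n (\<lambda>p. f (p + u + v) - f (p + v))"
      by (simp add: algebra_simps)
  qed
qed auto

lemma polydiff_Suc: "polydiff n f \<Longrightarrow> polydiff (Suc n) f"
proof (induction n arbitrary: f)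
  case (Suc n)
  then show ?case by (metis polydiff.simps(2))
qed auto

lemma polydiff_mono: "polydiff n f \<Longrightarrow> n \<le> m \<Longrightarrow> polydiff m f"
  by (induction m rule: nat_induct) (auto simp: le_Suc_eq simp del: polydiff.simps intro: polydiff_Suc)

text \<open>The discrete Leibniz rule writes the difference of a product as (difference of f) times
  shifted g, plus f times (difference of g); each summand has a smaller n + m.\<close>

lemma polydiff_mult:
  "polydiff (Suc n) f \<Longrightarrow> polydiff (Suc m) g \<Longrightarrow> polydiff (Suc (n + m)) (\<lambda>p. f p * g p)"
proof (induction "n + m" arbitrary: n m f g rule: less_induct)
  case less
  show ?case
  proof (subst polydiff.simps, intro allI)
    fix v
    have A: "polydiff (n + m) (\<lambda>p. (f (p + v) - f p) * g (p + v))"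
    proof (cases n)
      case 0
      then show ?thesis using less.prems by (auto intro: polydiff_zero)
    next
      case (Suc n')
      have "polydiff (Suc n') (\<lambda>p. f (p + v) - f p)"
        using less.prems(1) Suc by auto
      moreover have "polydiff (Suc m) (\<lambda>p. g (p + v))"
        using less.prems(2) by (rule polydiff_shift)
      ultimately show ?thesis using less.hyps[of n' m] Suc by simp
    qed
    have B: "polydiff (n + m) (\<lambda>p. f p * (g (p + v) - g p))"
    proof (cases m)
      case 0
      then show ?thesis using less.prems by (auto intro: polydiff_zero)
    next
      case (Suc m')
      have "polydiff (Suc m') (\<lambda>p. g (p + v) - g p)"
        using less.prems(2) Suc by auto
      then show ?thesis using less.hyps[of n m'] less.prems(1) Suc by simp
    qed
    show "polydiff (n + m) (\<lambda>p. f (p + v) * g (p + v) - f p * g p)"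
      using polydiff_add[OF A B] by (simp add: algebra_simps)
  qed
qed

text \<open>Level n stands for degree below n, so levels add up with a loss of one. A factor of
  level 0 is zero and imposes no bound; the guarded hypothesis is adapted to levels obtained by
  truncated subtraction.\<close>

lemma polydiff_mult':
  assumes "polydiff n f" "polydiff m g" "0 < n \<Longrightarrow> 0 < m \<Longrightarrow> n + m \<le> Suc k"
  shows "polydiff k (\<lambda>p. f p * g p)"
proof (cases "n = 0 \<or> m = 0")
  case True
  then have "(\<lambda>p. f p * g p) = (\<lambda>p. 0)" using assms by auto
  then show ?thesis by (simp only: polydiff_zero)
next
  case False
  then obtain n' m' where "n = Suc n'" "m = Suc m'" by (metis not0_implies_Suc)
  then show ?thesis
    using polydiff_mult[of n' f m' g] assms by (auto intro: polydiff_mono simp del: polydiff.simps)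
qed

text \<open>Finite differences involve only finitely many values, so they commute with pointwise
  limits and no uniformity in p enters.\<close>

lemma polydiff_lim:
  assumes "F \<noteq> bot" "eventually (\<lambda>t. polydiff n (g t)) F" "\<And>p. ((\<lambda>t. g t p) \<longlongrightarrow> h p) F"
  shows "polydiff n h"
  using assms(2,3)
proof (induction n arbitrary: g h)
  case 0
  have "h p = 0" for p
  proof -
    have "eventually (\<lambda>t. g t p = 0) F" using 0(1) by eventually_elim simp
    then have "((\<lambda>t. g t p) \<longlongrightarrow> 0) F" by (rule tendsto_eventually)
    then show ?thesis using 0(2) assms(1) tendsto_unique by blast
  qed
  then show ?case by simp
next
  case (Suc n)
  show ?case
  proof (subst polydiff.simps, intro allI)
    fix v
    show "polydiff n (\<lambda>p. h (p + v) - h p)"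
      by (rule Suc.IH[where g = "\<lambda>t p. g t (p + v) - g t p"])
         (use Suc.prems in \<open>auto intro: tendsto_diff elim: eventually_mono\<close>)
  qed
qed

section \<open>Base and fibre coordinates, and degree along the fibres\<close>

definition join :: "real^'n \<Rightarrow> real^'n \<Rightarrow> real^('n::finite + 'n)" where
  "join q p = (\<chi> i. case i of Inl \<alpha> \<Rightarrow> q $ \<alpha> | Inr \<alpha> \<Rightarrow> p $ \<alpha>)"

lemma join_nth [simp]: "join q p $ Inl \<alpha> = q $ \<alpha>" "join q p $ Inr \<alpha> = p $ \<alpha>"
  by (auto simp: join_def)

lemma q_part_join [simp]: "q_part (join q p) = q"
  by (auto simp: q_part_def vec_eq_iff)

lemma join_surj: "x = join (q_part x) (\<chi> \<alpha>. x $ Inr \<alpha>)"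
  by (auto simp: q_part_def vec_eq_iff join_def split: sum.split)

lemma join_shift_q: "join q p + t *\<^sub>R axis (Inl \<alpha>) 1 = join (q + t *\<^sub>R axis \<alpha> 1) p"
  by (auto simp: vec_eq_iff join_def axis_def split: sum.split)

lemma join_shift_p: "join q p + t *\<^sub>R axis (Inr \<alpha>) 1 = join q (p + t *\<^sub>R axis \<alpha> 1)"
  by (auto simp: vec_eq_iff join_def axis_def split: sum.split)

definition wt :: "'n + 'n \<Rightarrow> nat" where
  "wt i = (case i of Inl _ \<Rightarrow> 0 | Inr _ \<Rightarrow> 1)"

lemma wt_simps [simp]: "wt (Inl \<alpha>) = 0" "wt (Inr \<alpha>) = 1"
  by (auto simp: wt_def)

text \<open>A section of weight \<open>s\<close> has coefficients with \<open>n = s + 1 - k\<close>, where \<open>k\<close> is the weight of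
  \<open>\<hbar>\<^sup>h y\<^sup>M dx\<^sup>K\<close>; truncated subtraction makes the coefficient vanish for \<open>k > s\<close>.\<close>

definition fib_deg :: "(real^'n) set \<Rightarrow> nat \<Rightarrow> (real^('n::finite + 'n) \<Rightarrow> complex) \<Rightarrow> bool" where
  "fib_deg U n f \<longleftrightarrow> (\<forall>q\<in>U. polydiff n (\<lambda>p. f (join q p)))"

lemma fib_deg_zero: "fib_deg U n (\<lambda>x. 0)"
  by (simp add: fib_deg_def polydiff_zero)

lemma fib_deg_add: "fib_deg U n f \<Longrightarrow> fib_deg U n g \<Longrightarrow> fib_deg U n (\<lambda>x. f x + g x)"
  by (simp add: fib_deg_def polydiff_add)

lemma fib_deg_cmult: "fib_deg U n f \<Longrightarrow> fib_deg U n (\<lambda>x. c * f x)"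
  by (simp add: fib_deg_def polydiff_cmult)

lemma fib_deg_diff: "fib_deg U n f \<Longrightarrow> fib_deg U n g \<Longrightarrow> fib_deg U n (\<lambda>x. f x - g x)"
  using fib_deg_add[OF _ fib_deg_cmult[of U n g "-1"]] by simp

lemma fib_deg_sum: "(\<And>i. i \<in> S \<Longrightarrow> fib_deg U n (f i)) \<Longrightarrow> fib_deg U n (\<lambda>x. \<Sum>i\<in>S. f i x)"
  by (simp add: fib_deg_def polydiff_sum)

lemma fib_deg_mono: "fib_deg U n f \<Longrightarrow> n \<le> m \<Longrightarrow> fib_deg U m f"
  unfolding fib_deg_def using polydiff_mono by blast

lemma fib_deg_mult:
  assumes "fib_deg U n f" "fib_deg U m g" "0 < n \<Longrightarrow> 0 < m \<Longrightarrow> n + m \<le> Suc k"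
  shows "fib_deg U k (\<lambda>x. f x * g x)"
  using assms polydiff_mult' unfolding fib_deg_def by blast

lemma fib_deg_cong:
  assumes "\<And>x. q_part x \<in> U \<Longrightarrow> f x = g x" "fib_deg U n f"
  shows "fib_deg U n g"
proof -
  have "(\<lambda>p. f (join q p)) = (\<lambda>p. g (join q p))" if "q \<in> U" for q
    using assms(1) that by auto
  then show ?thesis using assms(2) unfolding fib_deg_def by auto
qed

text \<open>The quotient is written as a complex multiple of a difference of values of f, the shape
  to which \<open>polydiff_cmult\<close> applies.\<close>

lemma partial_tendsto:
  fixes f :: "real^'k::finite \<Rightarrow> complex"
  assumes "f differentiable (at x)"
  shows "((\<lambda>t. complex_of_real (1 / t) * (f (x + t *\<^sub>R axis i 1) - f x)) \<longlongrightarrow> partial i f x) (at 0)"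
proof -
  have 1: "(f has_derivative frechet_derivative f (at x)) (at (x + 0 *\<^sub>R axis i 1))"
    using assms by (simp add: frechet_derivative_works)
  have "((\<lambda>t::real. x + t *\<^sub>R axis i 1) has_derivative (\<lambda>t. t *\<^sub>R axis i 1)) (at 0)"
    by (auto intro!: derivative_eq_intros)
  from has_derivative_compose[OF this 1]
  have "((\<lambda>t. f (x + t *\<^sub>R axis i 1)) has_derivative (\<lambda>t. frechet_derivative f (at x) (t *\<^sub>R axis i 1))) (at 0)" .
  moreover have "linear (frechet_derivative f (at x))"
    using assms by (rule linear_frechet_derivative)
  ultimately have "((\<lambda>t. f (x + t *\<^sub>R axis i 1)) has_vector_derivative partial i f x) (at 0)"
    by (simp add: has_vector_derivative_def partial_def linear_scale)
  then have *: "((\<lambda>t. norm (f (x + t *\<^sub>R axis i 1) - f x - t *\<^sub>R partial i f x) / norm t) \<longlongrightarrow> 0) (at 0)"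
    by (simp add: has_vector_derivative_def has_derivative_at)
  have "((\<lambda>t. norm ((1 / t) *\<^sub>R (f (x + t *\<^sub>R axis i 1) - f x) - partial i f x)) \<longlongrightarrow> 0) (at 0)"
  proof (rule Lim_transform_eventually[OF *])
    have "norm (f (x + t *\<^sub>R axis i 1) - f x - t *\<^sub>R partial i f x) / norm t =
        norm ((1 / t) *\<^sub>R (f (x + t *\<^sub>R axis i 1) - f x) - partial i f x)" if "t \<noteq> 0" for t
    proof -
      have "(1 / t) *\<^sub>R (f (x + t *\<^sub>R axis i 1) - f x) - partial i f x =
          (1 / t) *\<^sub>R (f (x + t *\<^sub>R axis i 1) - f x - t *\<^sub>R partial i f x)"
        using that by (simp add: scaleR_diff_right)
      then show ?thesis by (simp add: divide_inverse)
    qed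
    then show "\<forall>\<^sub>F t in at 0. norm (f (x + t *\<^sub>R axis i 1) - f x - t *\<^sub>R partial i f x) / norm t =
        norm ((1 / t) *\<^sub>R (f (x + t *\<^sub>R axis i 1) - f x) - partial i f x)"
      by (simp add: eventually_at_filter)
  qed
  then have "((\<lambda>t. (1 / t) *\<^sub>R (f (x + t *\<^sub>R axis i 1) - f x) - partial i f x) \<longlongrightarrow> 0) (at 0)"
    by (rule tendsto_norm_zero_cancel)
  then show ?thesis
    by (simp add: LIM_zero_iff scaleR_conv_of_real)
qed

text \<open>The derivative is a limit of difference quotients. In a q direction these combine the
  restrictions of f to two fibres, and the level stays; openness of U keeps the second fibre over U.
  In a p direction they are multiples of a finite difference along one fibre, which lowers the level
  by one.\<close>

lemma fib_deg_partial:
  assumes "open U" and diff: "\<And>x. q_part x \<in> U \<Longrightarrow> f differentiable (at x)" and f: "fib_deg U n f"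
  shows "fib_deg U (n - wt i) (partial i f)"
  unfolding fib_deg_def
proof
  fix q assume q: "q \<in> U"
  let ?g = "\<lambda>t p. complex_of_real (1 / t) * (f (join q p + t *\<^sub>R axis i 1) - f (join q p))"
  show "polydiff (n - wt i) (\<lambda>p. partial i f (join q p))"
  proof (rule polydiff_lim[where F = "at (0::real)" and g = ?g])
    show "((\<lambda>t. ?g t p) \<longlongrightarrow> partial i f (join q p)) (at 0)" for p
      using q by (intro partial_tendsto diff) simp
    show "\<forall>\<^sub>F t in at 0. polydiff (n - wt i) (?g t)"
    proof (cases i)
      case (Inl \<alpha>)
      have "((\<lambda>t::real. q + t *\<^sub>R axis \<alpha> 1) \<longlongrightarrow> q + 0 *\<^sub>R axis \<alpha> 1) (at 0)"
        by (intro tendsto_intros)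
      then have "\<forall>\<^sub>F t in at 0. q + t *\<^sub>R axis \<alpha> 1 \<in> U"
        using \<open>open U\<close> q by (simp add: topological_tendstoD)
      then show ?thesis
      proof eventually_elim
        case (elim t)
        have "polydiff n (\<lambda>p. f (join (q + t *\<^sub>R axis \<alpha> 1) p) + (-1) * f (join q p))"
          using f elim q unfolding fib_deg_def by (intro polydiff_add polydiff_cmult) auto
        then show ?case
          using Inl by (intro polydiff_cmult) (simp add: join_shift_q)
      qed
    next
      case (Inr \<alpha>)
      have "polydiff (n - wt i) (?g t)" for t
      proof (rule polydiff_cmult)
        show "polydiff (n - wt i) (\<lambda>p. f (join q p + t *\<^sub>R axis i 1) - f (join q p))"
          using f q Inr unfolding fib_deg_def by (cases n) (auto simp: join_shift_p)
      qed
      then show ?thesis by simp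
    qed
  qed simp
qed

section \<open>The Weyl product\<close>

abbreviation np :: "('n + 'n) multiset \<Rightarrow> nat" where
  "np M \<equiv> (\<Sum>i\<in>#M. wt i)"

text \<open>The square of \<open>omega\<close> is minus the identity. Since
  \<open>matrix_inv\<close> is a choice, the two-sided inverse is exhibited as a witness and then
  identified by uniqueness.\<close>

lemma omega_inv_eq: "omega_inv = (- omega :: real^('n + 'n)^('n::finite + 'n))"
proof -
  let ?O = "omega :: real^('n + 'n)^('n + 'n)"
  have 1: "?O ** - ?O = mat 1"
  proof -
    have "(\<Sum>k\<in>UNIV. ?O $ i $ k * - ?O $ k $ j) = (if i = j then 1 else 0)" for i j
      by (cases i; cases j)
         (auto simp: omega_def UNIV_Plus_UNIV[symmetric] sum.Plus if_distrib[where f = "\<lambda>x. _ * x"]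
            if_distrib[where f = "\<lambda>x. x * _"] sum_negf simp del: UNIV_Plus_UNIV cong: if_cong)
    then show ?thesis
      by (simp add: matrix_matrix_mult_def mat_def vec_eq_iff)
  qed
  have 2: "- ?O ** ?O = mat 1"
  proof -
    have "- ?O ** ?O = ?O ** - ?O"
      by (simp add: matrix_matrix_mult_def vec_eq_iff)
    then show ?thesis using 1 by simp
  qed
  have "?O ** omega_inv = mat 1 \<and> omega_inv ** ?O = mat 1"
    unfolding omega_inv_def matrix_inv_def by (rule someI[of _ "- ?O"]) (use 1 2 in auto)
  then have "- ?O ** (?O ** omega_inv) = - ?O" by simp
  then show ?thesis using 2 by (simp add: matrix_mul_assoc)
qed

lemma omega_antisym: "omega $ j $ i = - (omega $ i $ j)"
  by (cases i; cases j) (auto simp: omega_def)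

lemma sum_omega_inv_omega: "(\<Sum>i\<in>UNIV. omega_inv $ i $ j * omega $ i $ k) = (if j = k then -1 else (0::real))"
  unfolding omega_inv_eq
  by (cases j; cases k)
     (auto simp: omega_def UNIV_Plus_UNIV[symmetric] sum.Plus if_distrib[where f = "\<lambda>x. _ * x"]
        if_distrib[where f = "\<lambda>x. x * _"] sum_negf simp del: UNIV_Plus_UNIV cong: if_cong)

lemma omega_inv_wt: "omega_inv $ i $ j \<noteq> 0 \<Longrightarrow> wt i + wt j = 1"
  by (cases i; cases j) (auto simp: omega_inv_eq omega_def)

lemma np_mset: "np (mset I) = (\<Sum>s<length I. wt (I ! s))"
  by (simp add: sum_mset_sum_list sum_list_sum_nth atLeast0LessThan flip: mset_map)

lemma prod_omega_inv_np:
  assumes "(\<Prod>s<t. omega_inv $ (I ! s) $ (J ! s)) \<noteq> 0" "length I = t" "length J = t"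
  shows "np (mset I) + np (mset J) = t"
proof -
  have "wt (I ! s) + wt (J ! s) = 1" if "s < t" for s
    using assms(1) that by (intro omega_inv_wt) auto
  then have "(\<Sum>s<t. wt (I ! s) + wt (J ! s)) = t" by simp
  then show ?thesis using assms by (simp add: np_mset sum.distrib)
qed

text \<open>The factor k is a product of multiplicities. Only its independence of u matters: it
  makes \<open>y_derivs\<close> linear and reduces weight and degree to a count of
  \<open>mset I + N\<close>.\<close>

lemma y_derivs_coeff: "\<exists>k::nat. \<forall>u. y_derivs I u N = of_nat k * u (mset I + N)"
proof (induction I arbitrary: N)
  case Nil
  have "\<forall>u. y_derivs [] u N = of_nat 1 * u (mset [] + N)" by (simp add: y_derivs_def)
  then show ?case by blast
next
  case (Cons i I)
  obtain k where "\<forall>u. y_derivs I u (add_mset i N) = of_nat k * u (mset I + add_mset i N)"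
    using Cons by blast
  then have "\<forall>u. y_derivs (i # I) u N = of_nat (Suc (count N i) * k) * u (mset (i # I) + N)"
    by (auto simp: y_derivs_def y_deriv_def algebra_simps)
  then show ?case by blast
qed

lemma y_derivs_add: "y_derivs I (\<lambda>M. u M + v M) N = y_derivs I u N + y_derivs I v N"
proof -
  obtain k :: nat where "\<forall>u. y_derivs I u N = of_nat k * u (mset I + N)"
    using y_derivs_coeff by blast
  then show ?thesis by (simp add: distrib_left)
qed

lemma weyl_term_add_left:
  "weyl_term t (\<lambda>M. a M + a' M) b M = weyl_term t a b M + weyl_term t a' b M"
  by (simp add: weyl_term_def y_derivs_add y_mult_def distrib_left distrib_right sum.distrib)

lemma weyl_term_add_right:
  "weyl_term t a (\<lambda>M. b M + b' M) M = weyl_term t a b M + weyl_term t a b' M"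
  by (simp add: weyl_term_def y_derivs_add y_mult_def distrib_left distrib_right sum.distrib)

lemma weyl_mult_add_left:
  "weyl_mult (\<lambda>M. a M + a' M) b M = weyl_mult a b M + weyl_mult a' b M"
  by (simp add: weyl_mult_def weyl_term_add_left fps_eq_iff sum.distrib)

lemma weyl_mult_add_right:
  "weyl_mult a (\<lambda>M. b M + b' M) M = weyl_mult a b M + weyl_mult a b' M"
  by (simp add: weyl_mult_def weyl_term_add_right fps_eq_iff sum.distrib)

lemma weyl_mult_zero: "weyl_mult (\<lambda>M. 0) b M = 0" "weyl_mult a (\<lambda>M. 0) M = 0"
  using weyl_mult_add_left[of "\<lambda>M. 0" "\<lambda>M. 0" b M] weyl_mult_add_right[of a "\<lambda>M. 0" "\<lambda>M. 0" M]
  by simp_all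

lemma weyl_term_nth:
  "fps_nth (weyl_term t a b M) h = (if h < t then 0 else
     1 / fact t * (- \<i> / 2) ^ t *
     (\<Sum>I | length I = t. \<Sum>J | length J = t.
        of_real (\<Prod>s<t. omega_inv $ (I ! s) $ (J ! s)) *
        fps_nth (y_mult (y_derivs I a) (y_derivs J b) M) (h - t)))"
proof -
  have "(fps_const (- \<i> / 2) * hbar) ^ t = fps_const ((- \<i> / 2) ^ t) * hbar ^ t"
    by (simp add: power_mult_distrib fps_const_power)
  then have "weyl_term t a b M = fps_const (1 / fact t * (- \<i> / 2) ^ t) * (hbar ^ t *
     (\<Sum>I | length I = t. \<Sum>J | length J = t.
        fps_const (of_real (\<Prod>s<t. omega_inv $ (I ! s) $ (J ! s))) *
        y_mult (y_derivs I a) (y_derivs J b) M))"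
    by (simp add: weyl_term_def mult.assoc flip: fps_const_mult)
  then show ?thesis
    by (simp add: fps_X_power_mult_nth fps_sum_nth)
qed

lemma fps_nth_of_nat_mult: "fps_nth (of_nat k * F) n = of_nat k * fps_nth F n"
  by (simp flip: fps_of_nat)

lemma weyl_mult_fib:
  fixes u v :: "real^('n::finite + 'n) \<Rightarrow> ('n + 'n) weyl"
  assumes *: "\<And>M1 h1 M2 h2. h1 + h2 + np M1 + np M2 = h + np M \<Longrightarrow>
      2 * h1 + size M1 + (2 * h2 + size M2) = 2 * h + size M \<Longrightarrow>
      fib_deg U n (\<lambda>x. fps_nth (u x M1) h1 * fps_nth (v x M2) h2)"
  shows "fib_deg U n (\<lambda>x. fps_nth (weyl_mult (u x) (v x) M) h)"
proof -
  have "fib_deg U n (\<lambda>x. fps_nth (weyl_term t (u x) (v x) M) h)" if "t \<le> h" for t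
  proof -
    have T: "fib_deg U n (\<lambda>x. of_real (\<Prod>s<t. omega_inv $ (I ! s) $ (J ! s)) *
        fps_nth (y_mult (y_derivs I (u x)) (y_derivs J (v x)) M) (h - t))"
      if IJ: "length I = t" "length J = t" for I J
    proof (cases "(\<Prod>s<t. omega_inv $ (I ! s) $ (J ! s)) = 0")
      case True
      then show ?thesis by (simp only: of_real_0 mult_zero_left fib_deg_zero)
    next
      case False
      then have np: "np (mset I) + np (mset J) = t" using IJ by (rule prod_omega_inv_np)
      show ?thesis
      proof (intro fib_deg_cmult)
        have "fib_deg U n (\<lambda>x. fps_nth (y_derivs I (u x) N) i * fps_nth (y_derivs J (v x) (M - N)) (h - t - i))"
          if "N \<subseteq># M" "i \<le> h - t" for N i
        proof -
          obtain k where k: "\<forall>u. y_derivs I u N = of_nat k * u (mset I + N)"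
            using y_derivs_coeff by blast
          obtain N' where M: "M = N + N'"
            using \<open>N \<subseteq># M\<close> by (metis subset_mset.add_diff_inverse)
          obtain l where l: "\<forall>u. y_derivs J u N' = of_nat l * u (mset J + N')"
            using y_derivs_coeff by blast
          have "fib_deg U n (\<lambda>x. of_nat (k * l) *
              (fps_nth (u x (mset I + N)) i * fps_nth (v x (mset J + N')) (h - t - i)))"
            using np IJ that \<open>t \<le> h\<close> by (intro fib_deg_cmult *) (auto simp: M)
          then show ?thesis
            by (simp add: k l fps_nth_of_nat_mult mult_ac M)
        qed
        then show "fib_deg U n (\<lambda>x. fps_nth (y_mult (y_derivs I (u x)) (y_derivs J (v x)) M) (h - t))"
          by (auto simp: y_mult_def fps_sum_nth fps_mult_nth intro!: fib_deg_sum)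
      qed
    qed
    have "fib_deg U n (\<lambda>x. 1 / fact t * (- \<i> / 2) ^ t *
        (\<Sum>I | length I = t. \<Sum>J | length J = t.
          of_real (\<Prod>s<t. omega_inv $ (I ! s) $ (J ! s)) *
          fps_nth (y_mult (y_derivs I (u x)) (y_derivs J (v x)) M) (h - t)))"
      by (rule fib_deg_cmult, rule fib_deg_sum, rule fib_deg_sum, rule T) auto
    then show ?thesis
      using that unfolding weyl_term_nth by (simp only: not_less[symmetric] if_False)
  qed
  then show ?thesis
    by (auto simp: weyl_mult_def intro!: fib_deg_sum)
qed

text \<open>The factors are controlled up to the degrees D1 and D2 and vanish below L1 and L2. As
  degrees add up, a coefficient of u beyond D1 could only meet a coefficient of v below L2, and
  conversely. The levels s1 and s2 lie one above the weights, whence the \<open>Suc\<close>.\<close>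

lemma weyl_mult_fib_deg:
  fixes u v :: "real^('n::finite + 'n) \<Rightarrow> ('n + 'n) weyl"
  assumes u: "\<And>M h. 2 * h + size M \<le> D1 \<Longrightarrow> fib_deg U (s1 - (h + np M)) (\<lambda>x. fps_nth (u x M) h)"
    and v: "\<And>M h. 2 * h + size M \<le> D2 \<Longrightarrow> fib_deg U (s2 - (h + np M)) (\<lambda>x. fps_nth (v x M) h)"
    and u0: "\<And>M h x. q_part x \<in> U \<Longrightarrow> 2 * h + size M < L1 \<Longrightarrow> fps_nth (u x M) h = 0"
    and v0: "\<And>M h x. q_part x \<in> U \<Longrightarrow> 2 * h + size M < L2 \<Longrightarrow> fps_nth (v x M) h = 0"
    and D: "2 * h + size M \<le> D1 + L2" "2 * h + size M \<le> D2 + L1"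
    and s: "s1 + s2 \<le> Suc (n + h + np M)"
  shows "fib_deg U n (\<lambda>x. fps_nth (weyl_mult (u x) (v x) M) h)"
proof (rule weyl_mult_fib)
  fix M1 M2 :: "('n + 'n) multiset" and h1 h2 :: nat
  assume 1: "h1 + h2 + np M1 + np M2 = h + np M"
    and 2: "2 * h1 + size M1 + (2 * h2 + size M2) = 2 * h + size M"
  show "fib_deg U n (\<lambda>x. fps_nth (u x M1) h1 * fps_nth (v x M2) h2)"
  proof (cases "2 * h1 + size M1 < L1 \<or> 2 * h2 + size M2 < L2")
    case True
    then show ?thesis
      using u0 v0 by (intro fib_deg_cong[OF _ fib_deg_zero]) auto
  next
    case False
    then show ?thesis
      using 1 2 D s by (intro fib_deg_mult[OF u v]) auto
  qed
qed

section \<open>The commutator with the form omega_ij y^i dx^j\<close>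

lemma y_mult_commute: "y_mult a b M = y_mult b a M"
proof -
  have "M - (M - N) = N" if "N \<subseteq># M" for N
    using that by (metis add_diff_cancel_right' subset_mset.add_diff_inverse)
  then show ?thesis
    unfolding y_mult_def
    by (intro sum.reindex_bij_witness[of _ "\<lambda>N. M - N" "\<lambda>N. M - N"]) (auto simp: mult.commute)
qed

lemma finite_submultisets: "finite {N. N \<subseteq># M}"
proof (rule finite_subset)
  show "{N. N \<subseteq># M} \<subseteq> mset ` {xs. set xs \<subseteq> set_mset M \<and> length xs \<le> size M}"
  proof
    fix N assume "N \<in> {N. N \<subseteq># M}"
    moreover obtain xs where "N = mset xs" by (metis ex_mset)
    ultimately show "N \<in> mset ` {xs. set xs \<subseteq> set_mset M \<and> length xs \<le> size M}"
      by (auto intro!: imageI dest: mset_subset_eqD size_mset_mono)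
  qed
qed (simp add: finite_lists_length_le)

lemma y_mult_const: "y_mult (\<lambda>M. if M = {#} then C else 0) b M = C * b M"
proof -
  have "y_mult (\<lambda>M. if M = {#} then C else 0) b M =
      (\<Sum>N | N \<subseteq># M. if N = {#} then C * b M else 0)"
    unfolding y_mult_def by (rule sum.cong) auto
  also have "\<dots> = C * b M"
    by (simp add: finite_submultisets)
  finally show ?thesis .
qed

lemma omega_form_eq:
  "omega_form [k] M = (\<Sum>i\<in>UNIV. if M = {#i#} then fps_const (of_real (omega $ i $ k)) else 0)"
proof (rule fps_ext)
  fix n
  show "fps_nth (omega_form [k] M) n =
      fps_nth (\<Sum>i\<in>UNIV. if M = {#i#} then fps_const (of_real (omega $ i $ k)) else 0) n"
    by (cases n) (auto simp: omega_form_def fps_sum_nth intro!: sum.cong sum.neutral)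
qed

lemma y_deriv_omega_form:
  "y_deriv i (omega_form [k]) = (\<lambda>M. if M = {#} then fps_const (of_real (omega $ i $ k)) else 0)"
proof
  fix M
  show "y_deriv i (omega_form [k]) M = (if M = {#} then fps_const (of_real (omega $ i $ k)) else 0)"
    by (cases "M = {#}") (auto simp: y_deriv_def omega_form_eq)
qed

lemma sum_lists_length_1: "(\<Sum>I | length I = Suc 0. f I) = (\<Sum>i\<in>UNIV. f [i])"
  by (rule sum.reindex_bij_witness[of _ "\<lambda>i. [i]" hd]) (auto simp: length_Suc_conv)

text \<open>The term with t contractions differentiates each factor t times, which annihilates
  anything at most linear in y as soon as t is at least 2.\<close>

lemma weyl_term_higher_zero:
  assumes "\<And>N. size N \<ge> 2 \<Longrightarrow> l N = 0" "t \<ge> 2"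
  shows "weyl_term t l a M = 0" "weyl_term t a l M = 0"
proof -
  have "y_derivs I l N = 0" if "length I = t" for I N
    using y_derivs_coeff[of I N] assms that by (metis le_add1 le_trans mult_zero_right size_mset size_union)
  then show "weyl_term t l a M = 0" "weyl_term t a l M = 0"
    by (simp_all add: weyl_term_def y_mult_def)
qed

text \<open>The uncontracted terms cancel because the commutative product is symmetric, and terms
  with two or more contractions vanish because \<open>omega_form\<close> is linear in y. The two
  single contractions differ in sign by antisymmetry of omega, so each contributes half of the
  result. After multiplication by i/hbar the bracket becomes minus delta.\<close>

lemma omega_form_commutator:
  "fps_nth (weyl_mult (omega_form [k]) a M - weyl_mult a (omega_form [k]) M) (Suc h) =
     \<i> * fps_nth (y_deriv k a M) h"
proof -
  let ?l = "omega_form [k]"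
  have hi: "weyl_term t ?l a M = 0" "weyl_term t a ?l M = 0" if "t \<ge> 2" for t
    using that by (intro weyl_term_higher_zero; force simp: omega_form_eq intro!: sum.neutral)+
  have split: "(\<Sum>t\<le>Suc h. f t) = f 0 + f 1" if "\<And>t. t \<ge> 2 \<Longrightarrow> f t = 0" for f :: "nat \<Rightarrow> complex"
  proof -
    have "2 \<le> t" if "t \<in> {..Suc h} - {0, 1}" for t
      using that by (cases t) auto
    then have "(\<Sum>t\<le>Suc h. f t) = (\<Sum>t\<in>{0,1}. f t)"
      using that by (intro sum.mono_neutral_right) auto
    then show ?thesis by simp
  qed
  have t0: "weyl_term 0 ?l a M = weyl_term 0 a ?l M"
    by (simp add: weyl_term_def y_derivs_def y_mult_commute)
  have A: "fps_nth (weyl_term 1 ?l a M) (Suc h) = - \<i> / 2 *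
      (\<Sum>i\<in>UNIV. \<Sum>j\<in>UNIV. of_real (omega_inv $ i $ j * omega $ i $ k) * fps_nth (y_deriv j a M) h)"
    unfolding weyl_term_nth
    by (simp add: sum_lists_length_1 y_derivs_def y_deriv_omega_form y_mult_const mult.assoc)
  have B: "fps_nth (weyl_term 1 a ?l M) (Suc h) = - \<i> / 2 *
      (\<Sum>i\<in>UNIV. \<Sum>j\<in>UNIV. of_real (omega_inv $ i $ j * omega $ j $ k) * fps_nth (y_deriv i a M) h)"
    unfolding weyl_term_nth
    by (simp add: sum_lists_length_1 y_derivs_def y_deriv_omega_form y_mult_const mult.assoc
          y_mult_commute[of _ "\<lambda>M. if M = {#} then _ else 0"])
  have "(\<Sum>i\<in>UNIV. \<Sum>j\<in>UNIV. of_real (omega_inv $ i $ j * omega $ i $ k) * fps_nth (y_deriv j a M) h)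
      = (\<Sum>j\<in>UNIV. of_real (\<Sum>i\<in>UNIV. omega_inv $ i $ j * omega $ i $ k) * fps_nth (y_deriv j a M) h)"
    by (subst sum.swap) (simp add: sum_distrib_right)
  also have "\<dots> = - fps_nth (y_deriv k a M) h"
    unfolding sum_omega_inv_omega by (simp add: if_distrib[where f = of_real] if_distrib[where f = "\<lambda>x. x * _"] cong: if_cong)
  finally have A': "fps_nth (weyl_term 1 ?l a M) (Suc h) = \<i> / 2 * fps_nth (y_deriv k a M) h"
    using A by simp
  have anti: "omega_inv $ i $ j * omega $ j $ k = - (omega_inv $ j $ i * omega $ j $ k)" for i j
    unfolding omega_inv_eq by (simp add: omega_antisym[of i j])
  have "(\<Sum>i\<in>UNIV. \<Sum>j\<in>UNIV. of_real (omega_inv $ i $ j * omega $ j $ k) * fps_nth (y_deriv i a M) h)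
      = (\<Sum>i\<in>UNIV. of_real (- (\<Sum>j\<in>UNIV. omega_inv $ j $ i * omega $ j $ k)) * fps_nth (y_deriv i a M) h)"
    by (simp add: sum_distrib_right anti flip: sum_negf)
  also have "\<dots> = fps_nth (y_deriv k a M) h"
    unfolding sum_omega_inv_omega by (simp add: if_distrib[where f = of_real] if_distrib[where f = "\<lambda>x. x * _"] if_distrib[where f = uminus] cong: if_cong)
  finally have B': "fps_nth (weyl_term 1 a ?l M) (Suc h) = - \<i> / 2 * fps_nth (y_deriv k a M) h"
    using B by simp
  have F1: "fps_nth (weyl_mult ?l a M) (Suc h) =
      fps_nth (weyl_term 0 ?l a M) (Suc h) + fps_nth (weyl_term 1 ?l a M) (Suc h)"
    unfolding weyl_mult_def fps_nth_Abs_fps by (rule split) (simp add: hi)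
  have F2: "fps_nth (weyl_mult a ?l M) (Suc h) =
      fps_nth (weyl_term 0 a ?l M) (Suc h) + fps_nth (weyl_term 1 a ?l M) (Suc h)"
    unfolding weyl_mult_def fps_nth_Abs_fps by (rule split) (simp add: hi)
  show ?thesis
    unfolding fps_sub_nth F1 F2 A' B' t0 by simp
qed

section \<open>The Abelian connection and its flat sections\<close>

lemma Pow_lessThan_1: "Pow {..<Suc 0} = {{}, {0}}"
  by (auto simp: lessThan_Suc Pow_insert)

lemma Pow_lessThan_2: "Pow {..<Suc (Suc 0)} = {{}, {0}, {1}, {0, 1}}"
  by (auto simp: lessThan_Suc Pow_insert)

lemma circ_Nil: "circ a b [] M = weyl_mult (a []) (b []) M"
proof -
  have "{(s::nat, t). s < t \<and> t \<in> {} \<and> s \<notin> {}} = {}" by auto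
  then show ?thesis by (simp add: circ_def)
qed

lemma circ_singleton:
  "circ a b [k] M = weyl_mult (a []) (b [k]) M + weyl_mult (a [k]) (b []) M"
proof -
  have c: "{(s::nat, t). s < t \<and> t \<in> {} \<and> s \<notin> {}} = {}"
    "{(s::nat, t). s < t \<and> t \<in> {0} \<and> s \<notin> {0}} = {}" by auto
  have n: "nths [k] {} = []" "nths [k] {0} = [k]" "nths [k] (- {}) = [k]" "nths [k] (- {0}) = []"
    by simp_all
  have len: "length [k] = Suc 0" by simp
  have sum: "(\<Sum>S\<in>{{}, {0}}. F S) = F {} + F {0}" for F :: "nat set \<Rightarrow> complex fps"
    by simp
  show ?thesis
    unfolding circ_def len Pow_lessThan_1 sum c n by simp
qed

lemma circ_doubleton:
  "circ a b [k, l] M = weyl_mult (a []) (b [k, l]) M + weyl_mult (a [k]) (b [l]) M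
     - weyl_mult (a [l]) (b [k]) M + weyl_mult (a [k, l]) (b []) M"
proof -
  have c: "{(s::nat, t). s < t \<and> t \<in> {} \<and> s \<notin> {}} = {}"
    "{(s::nat, t). s < t \<and> t \<in> {0} \<and> s \<notin> {0}} = {}"
    "{(s::nat, t). s < t \<and> t \<in> {0, 1} \<and> s \<notin> {0, 1}} = {}"
    "{(s::nat, t). s < t \<and> t \<in> {1} \<and> s \<notin> {1}} = {(0, 1)}" by auto
  have n: "nths [k, l] {} = []" "nths [k, l] {0} = [k]" "nths [k, l] {1} = [l]"
    "nths [k, l] {0, 1} = [k, l]" "nths [k, l] (- {}) = [k, l]" "nths [k, l] (- {0}) = [l]"
    "nths [k, l] (- {1}) = [k]" "nths [k, l] (- {0, 1}) = []"
    by (simp_all add: nths_Cons)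
  have len: "length [k, l] = Suc (Suc 0)" by simp
  have "{0::nat} \<noteq> {1}" "{0::nat} \<noteq> {0, 1}" "{1::nat} \<noteq> {0, 1}" by auto
  then have sum: "(\<Sum>S\<in>{{}, {0}, {1}, {0, 1}}. F S) = F {} + F {0} + F {1} + F {0, 1}"
    for F :: "nat set \<Rightarrow> complex fps"
    by (simp add: add.assoc del: One_nat_def)
  show ?thesis
    unfolding circ_def len Pow_lessThan_2 sum c n by simp
qed

text \<open>Euler's identity for homogeneous polynomials: multiplying by y^k means reading the
  coefficient of M with one k removed.\<close>

lemma sum_y_deriv:
  "(\<Sum>k\<in>set_mset M. y_deriv k u (M - {#k#})) = of_nat (size M) * u M"
proof -
  have "(\<Sum>k\<in>set_mset M. y_deriv k u (M - {#k#})) = (\<Sum>k\<in>set_mset M. of_nat (count M k) * u M)"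
  proof (rule sum.cong[OF refl])
    fix k assume "k \<in># M"
    then have "Suc (count M k - Suc 0) = count M k" by simp
    then show "y_deriv k u (M - {#k#}) = of_nat (count M k) * u M"
      using \<open>k \<in># M\<close> by (simp add: y_deriv_def del: of_nat_Suc)
  qed
  then show ?thesis
    by (simp add: size_multiset_overloaded_eq sum_distrib_right)
qed

lemma delta_doubleton: "delta a [k, l] M = y_deriv k (a [l]) M - y_deriv l (a [k]) M"
  by (simp add: delta_def drop_nth_def)

text \<open>The Hodge decomposition \<open>\<delta>\<delta>\<^sup>-\<^sup>1 + \<delta>\<^sup>-\<^sup>1\<delta> = 1\<close> on 1-forms.\<close>

lemma delta_inv_delta_one_form:
  assumes "delta_inv a = 0"
  shows "(\<Sum>k\<in>set_mset M. delta a [k, l] (M - {#k#})) = of_nat (Suc (size M)) * a [l] M"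
proof -
  \<comment> \<open>The condition \<open>delta_inv a = 0\<close>, read at the monomial y^l y^M, is
    the relation \<open>f0\<close> between the numbers f k; it evaluates the sum left over from
    delta.\<close>
  define f where "f k = a [k] (add_mset l M - {#k#})" for k
  have "delta_inv a [] (add_mset l M) = 0" using assms by simp
  then have f0: "(\<Sum>k\<in>insert l (set_mset M). f k) = 0"
    by (simp add: delta_inv_def f_def fps_eq_iff del: of_nat_Suc)
  have "(\<Sum>k\<in>set_mset M. y_deriv l (a [k]) (M - {#k#})) =
      (\<Sum>k\<in>set_mset M. of_nat (Suc (count M l)) * f k - (if k = l then f k else 0))"
  proof (rule sum.cong[OF refl])
    fix k assume k: "k \<in># M"
    \<comment> \<open>Removing k = l lowers the multiplicity of l by one. This correction occurs
      exactly when l lies in M, that is, when inserting l in \<open>f0\<close> adds nothing; in both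
      cases the sum comes out as - f l.\<close>
    have A: "of_nat (Suc (count (M - {#k#}) l)) =
        (of_nat (Suc (count M l)) - (if k = l then 1 else 0) :: complex fps)"
    proof (cases "k = l")
      case True
      then obtain c where "count M l = Suc c"
        using k by (metis count_eq_zero_iff not0_implies_Suc)
      then show ?thesis using True by simp
    qed simp
    have B: "add_mset l (M - {#k#}) = add_mset l M - {#k#}"
      using k by simp
    show "y_deriv l (a [k]) (M - {#k#}) =
        of_nat (Suc (count M l)) * f k - (if k = l then f k else 0)"
      unfolding y_deriv_def A B f_def[symmetric] by (simp add: left_diff_distrib del: of_nat_Suc)
  qed
  also have "\<dots> = of_nat (Suc (count M l)) * (\<Sum>k\<in>set_mset M. f k) - (if l \<in># M then f l else 0)"
    by (simp add: sum_subtractf sum_distrib_left del: of_nat_Suc)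
  also have "\<dots> = - f l"
  proof (cases "l \<in># M")
    case True
    then show ?thesis using f0 by (simp add: insert_absorb)
  next
    case False
    then have "(\<Sum>k\<in>set_mset M. f k) = - f l" using f0 by (simp add: eq_neg_iff_add_eq_0 add.commute)
    moreover have "count M l = 0" using False by (rule not_in_iff[THEN iffD1])
    ultimately show ?thesis using False by simp
  qed
  also have "f l = a [l] M" by (simp add: f_def)
  finally have "(\<Sum>k\<in>set_mset M. y_deriv l (a [k]) (M - {#k#})) = - a [l] M" .
  then show ?thesis
    unfolding delta_doubleton sum_subtractf sum_y_deriv by (simp add: distrib_right)
qed

lemma gamma_form_Nil [simp]: "gamma_form g x [] = (\<lambda>M. 0)"
  and gamma_form_doubleton [simp]: "gamma_form g x [k, l] = (\<lambda>M. 0)"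
  by (auto simp: gamma_form_def)

lemma gamma_form_eq_0:
  assumes "h \<noteq> 0 \<or> size M \<noteq> 2"
  shows "fps_nth (gamma_form g x [k] M) h = 0"
proof -
  have "M \<noteq> {#i, j#}" if "h = 0" for i j using assms that by auto
  then show ?thesis by (cases "h = 0") (auto simp: gamma_form_def)
qed

lemma ext_d_singleton:
  "fps_nth (ext_d a x [k] M) h = partial k (\<lambda>z. fps_nth (a z [] M) h) x"
  by (simp add: ext_d_def drop_nth_def)

lemma ext_d_doubleton:
  "fps_nth (ext_d a x [k, l] M) h =
     partial k (\<lambda>z. fps_nth (a z [l] M) h) x - partial l (\<lambda>z. fps_nth (a z [k] M) h) x"
  by (simp add: ext_d_def drop_nth_def)

lemma i_over_hbar_nth: "fps_nth (i_over_hbar a K M) h = \<i> * fps_nth (a K M) (Suc h)"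
  by (simp add: i_over_hbar_def)

lemma wt_le_1: "wt i \<le> 1"
  by (cases i) auto

lemma np_remove: "k \<in># M \<Longrightarrow> np M = wt k + np (M - {#k#})"
  by (subst insert_DiffM[of k M, symmetric], assumption) (simp only: image_mset_add_mset sum_mset.add_mset)

text \<open>As \<open>delta_inv\<close> annihilates r, the coefficient of y^M in r_l is a multiple
  of the sum of the coefficients of delta r at M with one y removed. The equation for delta r
  expresses these through gamma and through coefficients of r of smaller degree.\<close>

lemma connection_series_fib_deg:
  fixes r :: "real^('n::finite + 'n) \<Rightarrow> ('n + 'n) wform"
  assumes U: "open U"
    and g: "\<And>k M h. fib_deg U (2 - (wt k + (h + np M))) (\<lambda>x. fps_nth (gamma_form g x [k] M) h)"
    and dg: "\<And>k M h x. q_part x \<in> U \<Longrightarrow> (\<lambda>z. fps_nth (gamma_form g z [k] M) h) differentiable (at x)"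
    and dr: "\<And>k M h x. q_part x \<in> U \<Longrightarrow> (\<lambda>z. fps_nth (r z [k] M) h) differentiable (at x)"
    and r0: "\<And>x K M. q_part x \<in> U \<Longrightarrow> length K \<noteq> 1 \<Longrightarrow> r x K M = 0"
    and eq: "\<And>x. q_part x \<in> U \<Longrightarrow> delta (r x) = curvature_form (gamma_form g) x
        + cov_d 1 (gamma_form g) r x + i_over_hbar (circ (r x) (r x))"
    and inv: "\<And>x. q_part x \<in> U \<Longrightarrow> delta_inv (r x) = 0"
    and low: "\<And>x K M h. q_part x \<in> U \<Longrightarrow> fps_nth (r x K M) h \<noteq> 0 \<Longrightarrow> 3 \<le> 2 * h + size M"
  shows "fib_deg U (2 - (wt l + (h + np M))) (\<lambda>x. fps_nth (r x [l] M) h)"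
proof (induction "2 * h + size M" arbitrary: l h M rule: less_induct)
  case less
  have low2: "fps_nth (r x [k] N) i = 0" if "q_part x \<in> U" "2 * i + size N < 2" for x k N i
    using low[of x "[k]" N i] that by force
  have g2: "fps_nth (gamma_form g x [k] N) i = 0" if "q_part x \<in> U" "2 * i + size N < 2" for x k N i
    using that by (intro gamma_form_eq_0) auto
  have rhs: "fib_deg U (2 - (wt l + (h + np M))) (\<lambda>x. fps_nth (delta (r x) [k, l] (M - {#k#})) h)"
    if k: "k \<in># M" for k
  proof -
    define N where "N = M - {#k#}"
    define m where "m = 2 - (wt l + (h + np M))"
    have npM: "np M = wt k + np N" using k unfolding N_def by (rule np_remove)
    have szM: "size M = Suc (size N)" using k unfolding N_def by (metis size_Suc_Diff1)
    have IH: "fib_deg U (2 - (wt j + (i + np L))) (\<lambda>x. fps_nth (r x [j] L) i)"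
      if "2 * i + size L \<le> 2 * h + size N" for j i L
      using that szM by (intro less) auto
    \<comment> \<open>The coefficient of hbar^(h+1) is read because i/hbar follows. This raises the
      degree by 2, which is the least degree granted to the other factor, so neither factor exceeds
      the degree of hbar^h y^N.\<close>
    have deg: "2 * Suc h + size N \<le> (2 * h + size N) + 2" by simp
    have prod: "fib_deg U m (\<lambda>x. fps_nth (weyl_mult (u x) (v x) N) (Suc h))"
      if "\<And>i L. 2 * i + size L \<le> 2 * h + size N \<Longrightarrow> fib_deg U (2 - (wt j + (i + np L))) (\<lambda>x. fps_nth (u x L) i)"
        and "\<And>i L. 2 * i + size L \<le> 2 * h + size N \<Longrightarrow> fib_deg U (2 - (wt j' + (i + np L))) (\<lambda>x. fps_nth (v x L) i)"
        and "\<And>x i L. q_part x \<in> U \<Longrightarrow> 2 * i + size L < 2 \<Longrightarrow> fps_nth (u x L) i = 0"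
        and "\<And>x i L. q_part x \<in> U \<Longrightarrow> 2 * i + size L < 2 \<Longrightarrow> fps_nth (v x L) i = 0"
        and wts: "wt j + wt j' = wt k + wt l"
      for u v :: "real^('n + 'n) \<Rightarrow> ('n + 'n) weyl" and j j'
    proof -
      \<comment> \<open>Two factors of weight 1 give weight 2; the extra hbar in
        \<open>Suc h\<close> brings it back to 1. The form indices k and l are distributed over the
        factors, and wt k reappears in the weight of M.\<close>
      have s: "(2 - wt j) + (2 - wt j') \<le> Suc (m + Suc h + np N)"
        using wt_le_1[of j] wt_le_1[of j'] wts unfolding m_def npM by linarith
      show ?thesis
        by (rule weyl_mult_fib_deg[OF _ _ _ _ deg deg s]; (unfold diff_diff_left)?; rule that(1-4); assumption)
    qed
    note pkl = prod[where j = k and j' = l, OF _ _ _ _ refl]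
      and plk = prod[where j = l and j' = k, OF _ _ _ _ add.commute]
    have prods: "fib_deg U m (\<lambda>x. fps_nth (weyl_mult (gamma_form g x [k]) (gamma_form g x [l]) N) (Suc h))"
      "fib_deg U m (\<lambda>x. fps_nth (weyl_mult (gamma_form g x [k]) (r x [l]) N) (Suc h))"
      "fib_deg U m (\<lambda>x. fps_nth (weyl_mult (r x [k]) (gamma_form g x [l]) N) (Suc h))"
      "fib_deg U m (\<lambda>x. fps_nth (weyl_mult (r x [k]) (r x [l]) N) (Suc h))"
      "fib_deg U m (\<lambda>x. fps_nth (weyl_mult (gamma_form g x [l]) (gamma_form g x [k]) N) (Suc h))"
      "fib_deg U m (\<lambda>x. fps_nth (weyl_mult (gamma_form g x [l]) (r x [k]) N) (Suc h))"
      "fib_deg U m (\<lambda>x. fps_nth (weyl_mult (r x [l]) (gamma_form g x [k]) N) (Suc h))"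
      "fib_deg U m (\<lambda>x. fps_nth (weyl_mult (r x [l]) (r x [k]) N) (Suc h))"
      by (rule pkl plk; (rule g IH g2 low2)?; assumption?)+
    \<comment> \<open>Differentiation by x^k lowers the level by wt k, just the amount by which the
      weight of M exceeds that of N; for x^l it is the weight of dx^l that is matched.\<close>
    have partials: "fib_deg U m (partial k (\<lambda>z. fps_nth (gamma_form g z [l] N) h))"
      "fib_deg U m (partial k (\<lambda>z. fps_nth (r z [l] N) h))"
      "fib_deg U m (partial l (\<lambda>z. fps_nth (gamma_form g z [k] N) h))"
      "fib_deg U m (partial l (\<lambda>z. fps_nth (r z [k] N) h))"
      by (rule fib_deg_mono, rule fib_deg_partial[OF U], erule dg dr, rule g IH; simp add: m_def npM)+
    have *: "fib_deg U m (\<lambda>x.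
       (partial k (\<lambda>z. fps_nth (gamma_form g z [l] N) h) x - partial l (\<lambda>z. fps_nth (gamma_form g z [k] N) h) x)
       + \<i> * (fps_nth (weyl_mult (gamma_form g x [k]) (gamma_form g x [l]) N) (Suc h)
            - fps_nth (weyl_mult (gamma_form g x [l]) (gamma_form g x [k]) N) (Suc h))
       + ((partial k (\<lambda>z. fps_nth (r z [l] N) h) x - partial l (\<lambda>z. fps_nth (r z [k] N) h) x)
       + \<i> * ((fps_nth (weyl_mult (gamma_form g x [k]) (r x [l]) N) (Suc h)
            - fps_nth (weyl_mult (gamma_form g x [l]) (r x [k]) N) (Suc h))
            + (fps_nth (weyl_mult (r x [k]) (gamma_form g x [l]) N) (Suc h)
            - fps_nth (weyl_mult (r x [l]) (gamma_form g x [k]) N) (Suc h))))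
       + \<i> * (fps_nth (weyl_mult (r x [k]) (r x [l]) N) (Suc h)
            - fps_nth (weyl_mult (r x [l]) (r x [k]) N) (Suc h)))"
      by (intro fib_deg_add fib_deg_diff fib_deg_cmult prods partials)
    have "fib_deg U m (\<lambda>x. fps_nth (delta (r x) [k, l] N) h)"
    proof (rule fib_deg_cong[OF _ *])
      fix x assume x: "q_part x \<in> U"
      have z: "r x [] = (\<lambda>M. 0)" "r x [k, l] = (\<lambda>M. 0)"
        using r0[OF x] by auto
      show "(partial k (\<lambda>z. fps_nth (gamma_form g z [l] N) h) x - partial l (\<lambda>z. fps_nth (gamma_form g z [k] N) h) x)
       + \<i> * (fps_nth (weyl_mult (gamma_form g x [k]) (gamma_form g x [l]) N) (Suc h)
            - fps_nth (weyl_mult (gamma_form g x [l]) (gamma_form g x [k]) N) (Suc h))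
       + ((partial k (\<lambda>z. fps_nth (r z [l] N) h) x - partial l (\<lambda>z. fps_nth (r z [k] N) h) x)
       + \<i> * ((fps_nth (weyl_mult (gamma_form g x [k]) (r x [l]) N) (Suc h)
            - fps_nth (weyl_mult (gamma_form g x [l]) (r x [k]) N) (Suc h))
            + (fps_nth (weyl_mult (r x [k]) (gamma_form g x [l]) N) (Suc h)
            - fps_nth (weyl_mult (r x [l]) (gamma_form g x [k]) N) (Suc h))))
       + \<i> * (fps_nth (weyl_mult (r x [k]) (r x [l]) N) (Suc h)
            - fps_nth (weyl_mult (r x [l]) (r x [k]) N) (Suc h))
       = fps_nth (delta (r x) [k, l] N) h"
        unfolding eq[OF x] curvature_form_def cov_d_def plus_fun_apply fps_add_nth ext_d_doubleton
          i_over_hbar_nth wcomm_def circ_doubleton z gamma_form_Nil gamma_form_doubleton weyl_mult_zero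
        by simp
    qed
    then show ?thesis by (simp only: m_def N_def)
  qed
  have "fib_deg U (2 - (wt l + (h + np M))) (\<lambda>x. 1 / of_nat (Suc (size M)) *
      (\<Sum>k\<in>set_mset M. fps_nth (delta (r x) [k, l] (M - {#k#})) h))"
    by (intro fib_deg_cmult fib_deg_sum rhs)
  then show ?case
  proof (rule fib_deg_cong[rotated])
    fix x assume x: "q_part x \<in> U"
    have "(\<Sum>k\<in>set_mset M. fps_nth (delta (r x) [k, l] (M - {#k#})) h) =
        of_nat (Suc (size M)) * fps_nth (r x [l] M) h"
      using arg_cong[OF delta_inv_delta_one_form[OF inv[OF x], where M = M and l = l], of "\<lambda>F. fps_nth F h"]
      by (simp add: fps_sum_nth fps_nth_of_nat_mult del: of_nat_Suc)
    then show "1 / of_nat (Suc (size M)) *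
        (\<Sum>k\<in>set_mset M. fps_nth (delta (r x) [k, l] (M - {#k#})) h) = fps_nth (r x [l] M) h"
      by (simp del: of_nat_Suc)
  qed
qed

lemma add_ii_mult_eq_0_D: "p + \<i> * (\<i> * y + c) = 0 \<Longrightarrow> p + \<i> * c = y"
  by (simp add: distrib_left flip: mult.assoc) (simp add: algebra_simps add_eq_0_iff2)

text \<open>In the flatness equation \<open>omega_form\<close> contributes minus delta a, so the
  y-derivatives of a are given by its x-derivatives and by its bracket with gamma + r. Euler's
  identity recovers every coefficient with nonempty M; the coefficients at y = 0 are the initial
  data \<open>base\<close>.\<close>

lemma flat_section_fib_deg:
  fixes r a :: "real^('n::finite + 'n) \<Rightarrow> ('n + 'n) wform"
  assumes U: "open U"
    and g: "\<And>k M h. fib_deg U (2 - (wt k + (h + np M))) (\<lambda>x. fps_nth (gamma_form g x [k] M) h)"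
    and r: "\<And>k M h. fib_deg U (2 - (wt k + (h + np M))) (\<lambda>x. fps_nth (r x [k] M) h)"
    and da: "\<And>M h x. q_part x \<in> U \<Longrightarrow> (\<lambda>z. fps_nth (a z [] M) h) differentiable (at x)"
    and r0: "\<And>x K M. q_part x \<in> U \<Longrightarrow> length K \<noteq> 1 \<Longrightarrow> r x K M = 0"
    and a0: "\<And>x K M. q_part x \<in> U \<Longrightarrow> length K \<noteq> 0 \<Longrightarrow> a x K M = 0"
    and low: "\<And>x K M h. q_part x \<in> U \<Longrightarrow> fps_nth (r x K M) h \<noteq> 0 \<Longrightarrow> 3 \<le> 2 * h + size M"
    and eq: "\<And>x. q_part x \<in> U \<Longrightarrow> cov_d 0 (\<lambda>z. omega_form + gamma_form g z + r z) a x = 0"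
    and base: "\<And>h. fib_deg U (1 - h) (\<lambda>x. fps_nth (a x [] {#}) h)"
  shows "fib_deg U (1 - (h + np M)) (\<lambda>x. fps_nth (a x [] M) h)"
proof (induction "2 * h + size M" arbitrary: h M rule: less_induct)
  case less
  show ?case
  proof (cases "M = {#}")
    case True
    then show ?thesis using base by simp
  next
    case False
    let ?t = "\<lambda>k x. (\<lambda>M. gamma_form g x [k] M + r x [k] M)"
    have low2: "fps_nth (?t k x N) i = 0" if "q_part x \<in> U" "2 * i + size N < 2" for x k N i
    proof -
      have "fps_nth (r x [k] N) i = 0" using low[of x "[k]" N i] that by force
      moreover have "fps_nth (gamma_form g x [k] N) i = 0"
        using that by (intro gamma_form_eq_0) auto
      ultimately show ?thesis by simp
    qed
    have t: "fib_deg U (2 - (wt k + (i + np N))) (\<lambda>x. fps_nth (?t k x N) i)" for k i N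
      unfolding fps_add_nth by (intro fib_deg_add g r)
    have rhs: "fib_deg U (1 - (h + np M)) (\<lambda>x. fps_nth (y_deriv k (a x []) (M - {#k#})) h)"
      if k: "k \<in># M" for k
    proof -
      define N where "N = M - {#k#}"
      define m where "m = 1 - (h + np M)"
      have npM: "np M = wt k + np N" using k unfolding N_def by (rule np_remove)
      have szM: "size M = Suc (size N)" using k unfolding N_def by (metis size_Suc_Diff1)
      have IH: "fib_deg U (1 - (i + np L)) (\<lambda>x. fps_nth (a x [] L) i)"
        if "2 * i + size L \<le> 2 * h + size N" for i L
        using that szM by (intro less) auto
      \<comment> \<open>The bounds are asymmetric: gamma + r is controlled in all degrees and starts
        at degree 2, whereas a starts at degree 0 and is known only up to the degree of hbar^h
        y^N.\<close>
      have deg: "2 * Suc h + size N \<le> (2 * h + size N + 2) + 0" "2 * Suc h + size N \<le> (2 * h + size N) + 2"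
        by simp_all
      \<comment> \<open>Level 2 is weight 1 and level 1 is weight 0; the product has weight 1, and
        dividing by hbar leaves weight 0.\<close>
      have s: "(2 - wt k) + 1 \<le> Suc (m + Suc h + np N)" "1 + (2 - wt k) \<le> Suc (m + Suc h + np N)"
        using wt_le_1[of k] unfolding m_def npM by auto
      have p1: "fib_deg U m (\<lambda>x. fps_nth (weyl_mult (?t k x) (a x []) N) (Suc h))"
        by (rule weyl_mult_fib_deg[OF _ _ _ _ deg s(1), unfolded diff_diff_left]; (rule t IH low2)?; simp)
      have p2: "fib_deg U m (\<lambda>x. fps_nth (weyl_mult (a x []) (?t k x) N) (Suc h))"
        by (rule weyl_mult_fib_deg[OF _ _ _ _ deg(2,1) s(2), unfolded diff_diff_left]; (rule t IH low2)?; simp)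
      have p3: "fib_deg U m (partial k (\<lambda>z. fps_nth (a z [] N) h))"
        by (rule fib_deg_mono, rule fib_deg_partial[OF U], erule da, rule IH; simp add: m_def npM)
      have *: "fib_deg U m (\<lambda>x. partial k (\<lambda>z. fps_nth (a z [] N) h) x +
          \<i> * (fps_nth (weyl_mult (?t k x) (a x []) N) (Suc h) - fps_nth (weyl_mult (a x []) (?t k x) N) (Suc h)))"
        by (intro fib_deg_add fib_deg_diff fib_deg_cmult p1 p2 p3)
      have "fib_deg U m (\<lambda>x. fps_nth (y_deriv k (a x []) N) h)"
      proof (rule fib_deg_cong[OF _ *])
        fix x assume x: "q_part x \<in> U"
        let ?T = "omega_form + gamma_form g x + r x"
        have T: "?T [] = (\<lambda>M. 0)" "?T [k] = (\<lambda>M. omega_form [k] M + ?t k x M)" "a x [k] = (\<lambda>M. 0)"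
          using r0[OF x] a0[OF x] by (auto simp: omega_form_def)
        have "fps_nth (cov_d 0 (\<lambda>z. omega_form + gamma_form g z + r z) a x [k] N) h = 0"
          using eq[OF x] by simp
        then have "partial k (\<lambda>z. fps_nth (a z [] N) h) x + \<i> *
           (fps_nth (weyl_mult (omega_form [k]) (a x []) N - weyl_mult (a x []) (omega_form [k]) N) (Suc h) +
           (fps_nth (weyl_mult (?t k x) (a x []) N) (Suc h) - fps_nth (weyl_mult (a x []) (?t k x) N) (Suc h))) = 0"
          unfolding cov_d_def plus_fun_apply[of "ext_d a x"] plus_fun_apply[of "ext_d a x [k]"] fps_add_nth ext_d_singleton i_over_hbar_nth
            wcomm_def circ_singleton T weyl_mult_zero weyl_mult_add_left weyl_mult_add_right
          by (simp add: algebra_simps)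
        then have "partial k (\<lambda>z. fps_nth (a z [] N) h) x + \<i> *
           (\<i> * fps_nth (y_deriv k (a x []) N) h +
           (fps_nth (weyl_mult (?t k x) (a x []) N) (Suc h) - fps_nth (weyl_mult (a x []) (?t k x) N) (Suc h))) = 0"
          unfolding omega_form_commutator .
        then show "partial k (\<lambda>z. fps_nth (a z [] N) h) x +
          \<i> * (fps_nth (weyl_mult (?t k x) (a x []) N) (Suc h) - fps_nth (weyl_mult (a x []) (?t k x) N) (Suc h)) =
          fps_nth (y_deriv k (a x []) N) h"
          by (rule add_ii_mult_eq_0_D)
      qed
      then show ?thesis by (simp only: m_def N_def)
    qed
    have "fib_deg U (1 - (h + np M)) (\<lambda>x. 1 / of_nat (size M) *
        (\<Sum>k\<in>set_mset M. fps_nth (y_deriv k (a x []) (M - {#k#})) h))"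
      by (intro fib_deg_cmult fib_deg_sum rhs)
    then show ?thesis
    proof (rule fib_deg_cong[rotated])
      fix x assume x: "q_part x \<in> U"
      have "(\<Sum>k\<in>set_mset M. fps_nth (y_deriv k (a x []) (M - {#k#})) h) =
          of_nat (size M) * fps_nth (a x [] M) h"
        using arg_cong[OF sum_y_deriv[of "a x []" M], of "\<lambda>F. fps_nth F h"]
        by (simp add: fps_sum_nth fps_nth_of_nat_mult)
      then show "1 / of_nat (size M) *
          (\<Sum>k\<in>set_mset M. fps_nth (y_deriv k (a x []) (M - {#k#})) h) = fps_nth (a x [] M) h"
        using False by simp
    qed
  qed
qed

text \<open>Elements of weight \<open>0\<close> contain neither \<open>\<hbar>\<close> nor momentum directions, while every contraction
  with \<open>\<omega>\<^sup>i\<^sup>j\<close> involves a momentum direction.\<close>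

lemma weyl_mult_weight_zero:
  fixes u v :: "('n::finite + 'n) weyl"
  assumes u: "\<And>M h. h + np M > 0 \<Longrightarrow> fps_nth (u M) h = 0"
    and v: "\<And>M h. h + np M > 0 \<Longrightarrow> fps_nth (v M) h = 0"
  shows "weyl_mult u v {#} = fps_const (fps_nth (u {#}) 0 * fps_nth (v {#}) 0)"
proof (rule fps_ext)
  fix h
  show "fps_nth (weyl_mult u v {#}) h = fps_nth (fps_const (fps_nth (u {#}) 0 * fps_nth (v {#}) 0)) h"
  proof (cases h)
    case 0
    have "y_derivs [] w = w" for w :: "('n + 'n) weyl" by (simp add: y_derivs_def fun_eq_iff)
    then show ?thesis
      using 0 by (simp add: weyl_mult_def weyl_term_def y_mult_def)
  next
    case (Suc h')
    \<comment> \<open>Level 0 means vanishing, so \<open>weyl_mult_fib\<close> for constant families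
      shows that this coefficient is zero: a positive power of hbar at y = 0 has positive weight,
      which one of the two factors would have to carry.\<close>
    have "fib_deg UNIV 0 (\<lambda>x :: real^('n + 'n). fps_nth (weyl_mult u v {#}) h)"
    proof (rule weyl_mult_fib[where u = "\<lambda>_. u" and v = "\<lambda>_. v"])
      fix M1 M2 :: "('n + 'n) multiset" and h1 h2 :: nat
      assume "h1 + h2 + np M1 + np M2 = h + np ({#} :: ('n + 'n) multiset)"
      then have "h1 + np M1 > 0 \<or> h2 + np M2 > 0" using Suc by (auto; linarith)
      then have eq0: "fps_nth (u M1) h1 * fps_nth (v M2) h2 = 0" using u v by auto
      then show "fib_deg UNIV 0 (\<lambda>x :: real^('n + 'n). fps_nth (u M1) h1 * fps_nth (v M2) h2)"
        by (simp only: eq0 fib_deg_zero)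
    qed
    then show ?thesis using Suc by (simp add: fib_deg_def)
  qed
qed

section \<open>Proper Darboux charts\<close>

lemma partial_vec_nth:
  assumes "F differentiable (at x)"
  shows "partial j (\<lambda>z. F z $ i) x = frechet_derivative F (at x) (axis j 1) $ i"
proof -
  have "(F has_derivative frechet_derivative F (at x)) (at x)"
    using assms by (simp add: frechet_derivative_works)
  then have "((\<lambda>z. F z $ i) has_derivative (\<lambda>z. frechet_derivative F (at x) z $ i)) (at x)"
    by (rule bounded_linear.has_derivative[OF bounded_linear_vec_nth])
  then show ?thesis
    unfolding partial_def using frechet_derivative_at by metis
qed

lemma partial_compose:
  fixes F :: "real^'l::finite \<Rightarrow> real^'m::finite" and G :: "real^'k::finite \<Rightarrow> real^'l"
  assumes "G differentiable (at x)" "F differentiable (at (G x))"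
  shows "partial j (\<lambda>z. F (G z) $ i) x =
    (\<Sum>k\<in>UNIV. partial k (\<lambda>z. F z $ i) (G x) * partial j (\<lambda>z. G z $ k) x)"
proof -
  let ?F = "frechet_derivative F (at (G x))" and ?G = "frechet_derivative G (at x)"
  have "linear ?F" using assms(2) by (rule linear_frechet_derivative)
  then have "Vector_Spaces.linear (*s) (*s) ?F" by (simp add: linear_matrix_vector_mul_eq)
  then have "?F (?G (axis j 1)) $ i = (\<Sum>k\<in>UNIV. ?G (axis j 1) $ k * ?F (axis k 1) $ i)"
    by (rule linear_componentwise)
  moreover have "F \<circ> G differentiable (at x)"
    using assms by (rule differentiable_chain_at)
  then have "partial j (\<lambda>z. (F \<circ> G) z $ i) x = ?F (?G (axis j 1)) $ i"
    unfolding partial_vec_nth[OF \<open>F \<circ> G differentiable (at x)\<close>]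
      frechet_derivative_compose[OF assms] by simp
  ultimately show ?thesis
    using assms by (simp add: partial_vec_nth mult.commute)
qed

lemma partial_cong_open:
  assumes "open S" "x \<in> S" "\<And>z. z \<in> S \<Longrightarrow> f z = g z"
  shows "partial j f x = partial j g x"
proof -
  have "(f has_derivative D) (at x) \<longleftrightarrow> (g has_derivative D) (at x)" for D
    using has_derivative_transform_within_open[OF _ assms(1,2), of f D UNIV g]
      has_derivative_transform_within_open[OF _ assms(1,2), of g D UNIV f] assms(3) by auto
  then show ?thesis by (simp add: partial_def frechet_derivative_def)
qed

lemma is_chart_inj_on:
  assumes "is_chart X c"
  shows "inj_on (snd c) (fst c)"
proof -
  have "inj_on (snd c) (topspace (subtopology X (fst c)))"
    using assms unfolding is_chart_def by (intro homeomorphic_imp_injective_map) auto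
  moreover have "topspace (subtopology X (fst c)) = fst c"
    using assms unfolding is_chart_def by (simp add: openin_subset inf.absorb2)
  ultimately show ?thesis by simp
qed

lemma is_chart_open_image:
  assumes "is_chart X c" "openin X W" "W \<subseteq> fst c"
  shows "open (snd c ` W)"
proof -
  have "open_map (subtopology X (fst c)) (top_of_set (chart_image c)) (snd c)"
    using assms unfolding is_chart_def by (intro homeomorphic_imp_open_map) auto
  moreover have "openin (subtopology X (fst c)) W"
    using assms unfolding is_chart_def by (simp add: openin_open_subtopology)
  ultimately have "openin (top_of_set (chart_image c)) (snd c ` W)"
    unfolding open_map_def by blast
  then show ?thesis
    using assms unfolding is_chart_def by (blast intro: openin_open_trans)
qed

lemma smooth_on_differentiable: "smooth_on S f \<Longrightarrow> x \<in> S \<Longrightarrow> f differentiable (at x)"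
  unfolding smooth_on_def by (metis Ck_on.simps(2))

lemma chart_inv_eq: "inj_on (snd c) (fst c) \<Longrightarrow> y \<in> fst c \<Longrightarrow> chart_inv c (snd c y) = y"
  by (simp add: chart_inv_def)

lemma jac_self:
  assumes "smooth_manifold X A" "c \<in> A" "x \<in> fst c"
  shows "jac c c x i j = (if i = j then 1 else 0)"
proof -
  have c: "is_chart X c" using assms by (simp add: smooth_manifold_def)
  have "jac c c x i j = partial j (\<lambda>z. z $ i) (snd c x)"
    unfolding jac_def
  proof (rule partial_cong_open)
    show "open (chart_image c)" using c by (simp add: is_chart_def)
    show "snd c x \<in> chart_image c" using assms by (simp add: chart_image_def)
    show "transition c c z $ i = z $ i" if "z \<in> chart_image c" for z
      using that chart_inv_eq[OF is_chart_inj_on[OF c]]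
      by (auto simp: chart_image_def transition_def)
  qed
  also have "\<dots> = axis j 1 $ i"
    by (subst partial_vec_nth) (auto simp flip: frechet_derivative_at[OF has_derivative_ident])
  finally show ?thesis by (simp add: axis_def)
qed

text \<open>This is the chain rule for the composition of two transition maps. The composition
  formula holds on the triple overlap, whose image is open, so that derivatives may be compared
  there.\<close>

lemma jac_cocycle:
  assumes M: "smooth_manifold X A" and A: "c \<in> A" "c' \<in> A" "c'' \<in> A"
    and x: "x \<in> fst c" "x \<in> fst c'" "x \<in> fst c''"
  shows "jac c'' c x i j = (\<Sum>k\<in>UNIV. jac c' c x i k * jac c'' c' x k j)"
proof -
  have ch: "is_chart X c" "is_chart X c'" "is_chart X c''"
    using M A by (simp_all add: smooth_manifold_def)
  note inv = chart_inv_eq[OF is_chart_inj_on[OF ch(2)]] chart_inv_eq[OF is_chart_inj_on[OF ch(3)]]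
  have d1: "transition c'' c' differentiable (at (snd c'' x))"
    using M A x unfolding smooth_manifold_def smoothly_compatible_def
    by (intro smooth_on_differentiable[of "snd c'' ` (fst c'' \<inter> fst c')"]) auto
  have G: "transition c'' c' (snd c'' x) = snd c' x"
    using x by (simp add: transition_def inv)
  have d2: "transition c' c differentiable (at (transition c'' c' (snd c'' x)))"
    using M A x unfolding smooth_manifold_def smoothly_compatible_def G
    by (intro smooth_on_differentiable[of "snd c' ` (fst c' \<inter> fst c)"]) auto
  let ?W = "fst c \<inter> fst c' \<inter> fst c''"
  have "partial j (\<lambda>z. transition c'' c z $ i) (snd c'' x) =
      partial j (\<lambda>z. transition c' c (transition c'' c' z) $ i) (snd c'' x)"
  proof (rule partial_cong_open)
    show "open (snd c'' ` ?W)"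
      using ch by (intro is_chart_open_image[OF ch(3)]) (auto simp: is_chart_def)
    show "snd c'' x \<in> snd c'' ` ?W" using x by auto
    show "transition c'' c z $ i = transition c' c (transition c'' c' z) $ i"
      if "z \<in> snd c'' ` ?W" for z
      using that by (auto simp: transition_def inv)
  qed
  then show ?thesis
    unfolding jac_def partial_compose[OF d1 d2] by (simp add: G)
qed

text \<open>A covector is a family over all charts around x. Prescribing p in one chart fixes the
  others by the transformation law, and the cocycle identity for Jacobians makes the family
  consistent.\<close>

lemma covector_with_components:
  assumes M: "smooth_manifold X A" and c: "c \<in> A" and x: "x \<in> fst c"
  obtains \<xi> where "\<xi> \<in> cotangent_space A x" "\<xi> c = p"
proof
  define \<xi> where "\<xi> c' = (if c' \<in> A \<and> x \<in> fst c'
    then (\<chi> \<beta>. \<Sum>\<alpha>\<in>UNIV. jac c' c x \<alpha> \<beta> * p $ \<alpha>) else 0)" for c'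
  have trans: "\<xi> c'' $ \<beta> = (\<Sum>\<alpha>\<in>UNIV. jac c'' c' x \<alpha> \<beta> * \<xi> c' $ \<alpha>)"
    if "c' \<in> A" "c'' \<in> A" "x \<in> fst c'" "x \<in> fst c''" for c' c'' \<beta>
  proof -
    have "\<xi> c'' $ \<beta> = (\<Sum>\<delta>\<in>UNIV. \<Sum>\<alpha>\<in>UNIV. jac c' c x \<delta> \<alpha> * jac c'' c' x \<alpha> \<beta> * p $ \<delta>)"
      using that by (simp add: \<xi>_def jac_cocycle[OF M c that(1,2) x that(3,4)] sum_distrib_right)
    also have "\<dots> = (\<Sum>\<alpha>\<in>UNIV. \<Sum>\<delta>\<in>UNIV. jac c' c x \<delta> \<alpha> * jac c'' c' x \<alpha> \<beta> * p $ \<delta>)"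
      by (rule sum.swap)
    also have "\<dots> = (\<Sum>\<alpha>\<in>UNIV. jac c'' c' x \<alpha> \<beta> * \<xi> c' $ \<alpha>)"
      using that by (simp add: \<xi>_def sum_distrib_left mult_ac)
    finally show ?thesis .
  qed
  have "\<xi> c' = 0" if "\<not> (c' \<in> A \<and> x \<in> fst c')" for c'
    using that by (auto simp: \<xi>_def)
  then show "\<xi> \<in> cotangent_space A x"
    unfolding cotangent_space_def using trans by blast
  show "\<xi> c = p"
    using c x by (simp add: \<xi>_def vec_eq_iff jac_self[OF M c x] if_distrib[where f = "\<lambda>x. x * _"] cong: if_cong)
qed

text \<open>Every momentum is attained because covectors can have arbitrary components. The image
  thus contains whole fibres, as finite differences in p require.\<close>

lemma chart_image_darboux_chart:
  assumes "smooth_manifold X A" "c \<in> A"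
  shows "chart_image (darboux_chart A c) = {x. q_part x \<in> chart_image c}"
proof (intro set_eqI iffI)
  fix z assume "z \<in> chart_image (darboux_chart A c)"
  then show "z \<in> {x. q_part x \<in> chart_image c}"
    by (auto simp: chart_image_def darboux_chart_def q_part_def)
next
  fix z assume "z \<in> {x. q_part x \<in> chart_image c}"
  then obtain x where x: "x \<in> fst c" "q_part z = snd c x"
    by (auto simp: chart_image_def)
  obtain \<xi> where \<xi>: "\<xi> \<in> cotangent_space A x" "\<xi> c = (\<chi> \<alpha>. z $ Inr \<alpha>)"
    using covector_with_components[OF assms x(1)] by blast
  have "snd (darboux_chart A c) (x, \<xi>) = z"
    using x(2) \<xi>(2) by (auto simp: darboux_chart_def vec_eq_iff q_part_def split: sum.split)
  moreover have "(x, \<xi>) \<in> fst (darboux_chart A c)"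
    using x \<xi> by (simp add: darboux_chart_def)
  ultimately show "z \<in> chart_image (darboux_chart A c)"
    unfolding chart_image_def by (metis imageI)
qed

section \<open>The weight of the symplectic connection\<close>

text \<open>Vanishing torsion gives the symmetry in the last two indices. Since omega is constant in
  Darboux charts, parallelism of omega reduces to the symmetry in the first two.\<close>

lemma lower_symmetric:
  assumes "symplectic_connection P \<gamma>" "C \<in> P" "x \<in> chart_image C"
  shows "lower (\<gamma> C) x i j k = lower (\<gamma> C) x i k j" "lower (\<gamma> C) x i j k = lower (\<gamma> C) x j i k"
proof -
  show "lower (\<gamma> C) x i j k = lower (\<gamma> C) x i k j"
    using assms unfolding symplectic_connection_def torsion_free_def lower_def by simp
  have "partial k (\<lambda>_. omega $ i $ j) x
          - (\<Sum>l\<in>UNIV. \<gamma> C x l i k * omega $ l $ j)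
          - (\<Sum>l\<in>UNIV. \<gamma> C x l j k * omega $ i $ l) = 0"
    using assms unfolding symplectic_connection_def by blast
  moreover have "partial k (\<lambda>_. omega $ i $ j) x = 0"
    by (simp add: partial_def)
  moreover have "(\<Sum>l\<in>UNIV. \<gamma> C x l i k * omega $ l $ j) = - lower (\<gamma> C) x j i k"
    by (simp add: lower_def omega_antisym[of _ j] sum_negf mult.commute)
  moreover have "(\<Sum>l\<in>UNIV. \<gamma> C x l j k * omega $ i $ l) = lower (\<gamma> C) x i j k"
    by (simp add: lower_def mult.commute)
  ultimately show "lower (\<gamma> C) x i j k = lower (\<gamma> C) x j i k" by simp
qed

text \<open>The compatibility conditions say this case by case: linear in p without momentum
  indices, constant along the fibres with one, zero with two or three. They are stated for one order
  of the indices, and total symmetry supplies the others.\<close>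

lemma lower_fib_deg:
  assumes M: "smooth_manifold X A" and c: "c \<in> A"
    and symp: "symplectic_connection P \<gamma>" and P: "darboux_chart A c \<in> P"
    and comp: "compatible_connection A \<Gamma> \<gamma>"
  shows "fib_deg (chart_image c) (2 - (wt i + wt j + wt k))
    (\<lambda>x. complex_of_real (lower (\<gamma> (darboux_chart A c)) x i j k))"
proof -
  define g where "g = lower (\<gamma> (darboux_chart A c))"
  define U where "U = chart_image c"
  have D: "x \<in> chart_image (darboux_chart A c) \<longleftrightarrow> q_part x \<in> U" for x
    using chart_image_darboux_chart[OF M c] by (simp add: U_def)
  have sym1: "g x i j k = g x i k j" and sym2: "g x i j k = g x j i k" if "q_part x \<in> U" for x i j k
    using lower_symmetric[OF symp P, of x] that unfolding D g_def by auto
  note comp' = comp[unfolded compatible_connection_def Let_def, rule_format, OF c, folded g_def]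
  have xin: "x \<in> chart_image (darboux_chart A c)" if "q_part x \<in> U" for x
    using that by (simp add: D)
  have IJK: "g x (Inr i) (Inr j) (Inr k) = 0"
    and IJa: "g x (Inr i) (Inr j) (Inl \<alpha>) = 0"
    and Iab: "g x (Inr i) (Inl \<alpha>) (Inl \<beta>) = - \<Gamma> c (q_part x) i \<alpha> \<beta>"
    if "q_part x \<in> U" for x i j k \<alpha> \<beta>
    using comp' xin[OF that] by blast+
  obtain f where "\<forall>x\<in>chart_image (darboux_chart A c). \<forall>\<alpha> \<beta> \<delta>.
      g x (Inl \<alpha>) (Inl \<beta>) (Inl \<delta>) = (\<Sum>\<epsilon>\<in>UNIV. x $ Inr \<epsilon> * f \<epsilon> \<alpha> \<beta> \<delta> (q_part x))"
    using comp' by (elim conjE exE) (rule that)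
  then have f: "g x (Inl \<alpha>) (Inl \<beta>) (Inl \<delta>) = (\<Sum>\<epsilon>\<in>UNIV. x $ Inr \<epsilon> * f \<epsilon> \<alpha> \<beta> \<delta> (q_part x))"
    if "q_part x \<in> U" for x \<alpha> \<beta> \<delta>
    using xin[OF that] by blast
  have two: "fib_deg U n (\<lambda>x. of_real (g x i j k))" if "\<And>x. q_part x \<in> U \<Longrightarrow> g x i j k = 0" for n i j k
    by (rule fib_deg_cong[OF _ fib_deg_zero]) (simp add: that)
  have one: "fib_deg U 1 (\<lambda>x. of_real (g x i j k))"
    if "\<And>x. q_part x \<in> U \<Longrightarrow> g x i j k = G (q_part x)" for i j k G
    unfolding fib_deg_def by (simp add: that)
  have zero: "fib_deg U 2 (\<lambda>x. of_real (g x (Inl \<alpha>) (Inl \<beta>) (Inl \<delta>)))" for \<alpha> \<beta> \<delta>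
    unfolding fib_deg_def
  proof
    fix q assume "q \<in> U"
    have "polydiff 2 (\<lambda>p. \<Sum>\<epsilon>\<in>UNIV. of_real (f \<epsilon> \<alpha> \<beta> \<delta> q) * complex_of_real (p $ \<epsilon>))"
      by (intro polydiff_sum polydiff_cmult) (simp add: numeral_2_eq_2)
    then show "polydiff 2 (\<lambda>p. complex_of_real (g (join q p) (Inl \<alpha>) (Inl \<beta>) (Inl \<delta>)))"
      using \<open>q \<in> U\<close> by (simp add: f mult.commute)
  qed
  have "fib_deg U (2 - (wt i + wt j + wt k)) (\<lambda>x. of_real (g x i j k))"
  proof (cases i; cases j; cases k)
    fix \<alpha> \<beta> \<delta> assume ijk: "i = Inl \<alpha>" "j = Inl \<beta>" "k = Inl \<delta>"
    show ?thesis using zero by (simp add: ijk)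
  next
    fix \<alpha> \<beta> \<delta> assume ijk: "i = Inr \<alpha>" "j = Inl \<beta>" "k = Inl \<delta>"
    have "fib_deg U 1 (\<lambda>x. of_real (g x i j k))"
      unfolding ijk by (rule one) (rule Iab)
    then show ?thesis by (simp add: ijk)
  next
    fix \<alpha> \<beta> \<delta> assume ijk: "i = Inl \<alpha>" "j = Inr \<beta>" "k = Inl \<delta>"
    have "fib_deg U 1 (\<lambda>x. of_real (g x i j k))"
      unfolding ijk by (rule one, subst sym2, assumption, rule Iab)
    then show ?thesis by (simp add: ijk)
  next
    fix \<alpha> \<beta> \<delta> assume ijk: "i = Inl \<alpha>" "j = Inl \<beta>" "k = Inr \<delta>"
    have "fib_deg U 1 (\<lambda>x. of_real (g x i j k))"
      unfolding ijk by (rule one, subst sym1, assumption, subst sym2, assumption, rule Iab)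
    then show ?thesis by (simp add: ijk)
  next
    fix \<alpha> \<beta> \<delta> assume ijk: "i = Inr \<alpha>" "j = Inr \<beta>" "k = Inl \<delta>"
    show ?thesis unfolding ijk by (rule two) (rule IJa)
  next
    fix \<alpha> \<beta> \<delta> assume ijk: "i = Inr \<alpha>" "j = Inl \<beta>" "k = Inr \<delta>"
    show ?thesis unfolding ijk by (rule two, subst sym1, assumption, rule IJa)
  next
    fix \<alpha> \<beta> \<delta> assume ijk: "i = Inl \<alpha>" "j = Inr \<beta>" "k = Inr \<delta>"
    show ?thesis unfolding ijk by (rule two, subst sym2, assumption, subst sym1, assumption, rule IJa)
  next
    fix \<alpha> \<beta> \<delta> assume ijk: "i = Inr \<alpha>" "j = Inr \<beta>" "k = Inr \<delta>"
    show ?thesis unfolding ijk by (rule two) (rule IJK)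
  qed
  then show ?thesis by (simp add: g_def U_def)
qed

lemma gamma_form_nth_0:
  "fps_nth (gamma_form g x [k] M) 0 =
     (\<Sum>i\<in>UNIV. \<Sum>j\<in>UNIV. (if M = {#i, j#} then 1 / 2 else 0) * complex_of_real (lower g x i j k))"
  by (auto simp: gamma_form_def intro!: sum.cong)

text \<open>The first two indices of the lowered connection sit in y and the third in dx, so
  counting momentum indices is counting np M + wt k.\<close>

lemma gamma_form_fib_deg:
  assumes "\<And>i j k. fib_deg U (2 - (wt i + wt j + wt k)) (\<lambda>x. complex_of_real (lower g x i j k))"
  shows "fib_deg U (2 - (wt k + (h + np M))) (\<lambda>x. fps_nth (gamma_form g x [k] M) h)"
proof (cases "h = 0")
  case True
  have "fib_deg U (2 - (wt k + (h + np M)))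
      (\<lambda>x. (if M = {#i, j#} then 1 / 2 else 0) * complex_of_real (lower g x i j k))" for i j
  proof (cases "M = {#i, j#}")
    case M: True
    have "fib_deg U (2 - (wt k + (h + np M))) (\<lambda>x. complex_of_real (lower g x i j k))"
      using assms[of i j k] by (simp add: True M add_ac)
    then show ?thesis unfolding if_P[OF M] by (rule fib_deg_cmult)
  next
    case False
    then show ?thesis by (simp add: fib_deg_zero)
  qed
  then show ?thesis
    unfolding True gamma_form_nth_0 by (intro fib_deg_sum) simp
next
  case False
  then show ?thesis by (simp add: gamma_form_eq_0 fib_deg_zero)
qed

lemma gamma_form_differentiable:
  assumes "\<And>i j k. (\<lambda>x. g x i j k) differentiable (at x)"
  shows "(\<lambda>z. fps_nth (gamma_form g z [k] M) h) differentiable (at x)"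
proof (cases "h = 0")
  case True
  have "(\<lambda>z. lower g z i j k) differentiable (at x)" for i j
    unfolding lower_def by (intro differentiable_sum) (auto simp: assms)
  then have "(\<lambda>z. complex_of_real (lower g z i j k)) differentiable (at x)" for i j
    using differentiable_compose[OF bounded_linear_imp_differentiable[OF bounded_linear_of_real]] by blast
  then show ?thesis
    unfolding True gamma_form_nth_0 by (intro differentiable_sum differentiable_mult) auto
next
  case False
  then show ?thesis by (simp add: gamma_form_eq_0)
qed

lemma weyl_section_differentiable:
  assumes "weyl_section P m a" "c \<in> P" "x \<in> chart_image c"
  shows "(\<lambda>z. fps_nth (a c z K M) h) differentiable (at x)"
  using assms unfolding weyl_section_def by (blast intro: smooth_on_differentiable)

lemma weyl_section_form_degree:
  assumes "weyl_section P m a" "c \<in> P" "x \<in> chart_image c" "length K \<noteq> m"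
  shows "a c x K M = 0"
  using assms unfolding weyl_section_def by blast

text \<open>The chart belongs to two families: Q, where gamma is symplectic, and P, where the
  Abelian connection and the lift are given. Weight 0 means level 1 - (h + np N), which truncates to
  0 as soon as hbar or a momentum direction occurs.\<close>

lemma flat_lift_weight_zero:
  fixes \<gamma> :: "(('m, 'n::finite) cotangent_point, 'n + 'n) connection"
  assumes M: "smooth_manifold X A" and c: "c \<in> A"
    and symp: "symplectic_connection Q \<gamma>" and Q: "darboux_chart A c \<in> Q"
    and comp: "compatible_connection A \<Gamma> \<gamma>"
    and P: "darboux_chart A c \<in> P"
    and r: "abelian_connection_series P \<gamma> r" and a: "flat_lift P \<gamma> r a0 a"
    and a0: "depends_only_on_q (darboux_chart A c) a0"
    and w: "w \<in> fst (darboux_chart A c)"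
  shows "h + np N > 0 \<Longrightarrow> fps_nth (a (darboux_chart A c) (snd (darboux_chart A c) w) [] N) h = 0"
    and "fps_nth (a (darboux_chart A c) (snd (darboux_chart A c) w) [] {#}) 0 = a0 w"
proof -
  define C where "C = darboux_chart A c"
  define U where "U = chart_image c"
  have D: "chart_image C = {x. q_part x \<in> U}"
    using chart_image_darboux_chart[OF M c] by (simp add: U_def C_def)
  have Dx: "x \<in> chart_image C \<longleftrightarrow> q_part x \<in> U" for x by (simp add: D)
  then have xin: "q_part x \<in> U \<Longrightarrow> x \<in> chart_image C" for x by blast
  have U: "open U" using M c by (simp add: smooth_manifold_def is_chart_def U_def)
  have CP: "C \<in> P" "C \<in> Q" using P Q by (simp_all add: C_def)
  have dg: "(\<lambda>x. \<gamma> C x i j k) differentiable (at x)" if "q_part x \<in> U" for x i j k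
    using symp CP(2) xin[OF that] unfolding symplectic_connection_def linear_connection_def
    by (blast intro: smooth_on_differentiable)
  have g: "fib_deg U (2 - (wt k + (h + np M))) (\<lambda>x. fps_nth (gamma_form (\<gamma> C) x [k] M) h)" for k M h
    unfolding U_def C_def by (rule gamma_form_fib_deg, rule lower_fib_deg[OF M c symp Q comp])
  have wr: "weyl_section P 1 r" and wa: "weyl_section P 0 a"
    using r a by (simp_all add: abelian_connection_series_def flat_lift_def)
  note r0 = weyl_section_form_degree[OF wr CP(1) xin]
    and a0' = weyl_section_form_degree[OF wa CP(1) xin]
    and dr = weyl_section_differentiable[OF wr CP(1) xin]
    and da = weyl_section_differentiable[OF wa CP(1) xin]
  have low: "3 \<le> 2 * h + size M" if "q_part x \<in> U" "fps_nth (r C x K M) h \<noteq> 0" for x K M h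
    using r CP(1) xin[OF that(1)] that(2) unfolding abelian_connection_series_def by blast
  have rf: "fib_deg U (2 - (wt l + (h + np M))) (\<lambda>x. fps_nth (r C x [l] M) h)" for l M h
  proof (rule connection_series_fib_deg[where g = "\<gamma> C"])
    show "(\<lambda>z. fps_nth (gamma_form (\<gamma> C) z [k] M) h) differentiable (at x)" if "q_part x \<in> U" for k M h x
      using dg[OF that] by (rule gamma_form_differentiable)
    show "delta (r C x) = curvature_form (gamma_form (\<gamma> C)) x
        + cov_d 1 (gamma_form (\<gamma> C)) (r C) x + i_over_hbar (circ (r C x) (r C x))"
      "delta_inv (r C x) = 0" if "q_part x \<in> U" for x
      using r CP(1) xin[OF that] unfolding abelian_connection_series_def by blast+
  qed (rule U g dr r0 low; assumption)+
  have base_eq: "a C x [] {#} = fps_const (a0 (chart_inv C x))" if "q_part x \<in> U" for x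
    using a CP(1) xin[OF that] unfolding flat_lift_def by blast
  have chart_inv_C: "chart_inv C x \<in> fst C" "snd C (chart_inv C x) = x" if "q_part x \<in> U" for x
    using xin[OF that] unfolding chart_inv_def chart_image_def by (rule inv_into_into, rule f_inv_into_f)
  have a0_fibre: "a0 (chart_inv C x) = a0 w'"
    if "q_part x \<in> U" "w' \<in> fst C" "q_part (snd C w') = q_part x" for x w'
  proof -
    have "q_part (snd C (chart_inv C x)) = q_part (snd C w')"
      by (simp only: chart_inv_C[OF that(1)] that(3))
    then show ?thesis
      using a0 chart_inv_C(1)[OF that(1)] that(2) unfolding depends_only_on_q_def C_def[symmetric] by blast
  qed
  \<comment> \<open>A function of q alone is constant along the fibres, which is level 1; the lift
    restricts at y = 0 to a0 without powers of hbar, which gives level 0 for positive h.\<close>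
  have base: "fib_deg U (1 - h) (\<lambda>x. fps_nth (a C x [] {#}) h)" for h
  proof (cases "h = 0")
    case True
    have "a0 (chart_inv C (join q p)) = a0 (chart_inv C (join q p'))" if "q \<in> U" for q p p'
      using that by (intro a0_fibre) (simp_all add: chart_inv_C)
    then have "polydiff 1 (\<lambda>p. a0 (chart_inv C (join q p)))" if "q \<in> U" for q
      unfolding One_nat_def polydiff.simps right_minus_eq using that by blast
    then show ?thesis
      unfolding True fib_deg_def by (simp add: base_eq)
  next
    case False
    then show ?thesis
      by (intro fib_deg_cong[OF _ fib_deg_zero]) (simp add: base_eq)
  qed
  have af: "fib_deg U (1 - (h + np M)) (\<lambda>x. fps_nth (a C x [] M) h)" for M h
  proof (rule flat_section_fib_deg[where g = "\<gamma> C" and r = "r C"])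
    show "cov_d 0 (\<lambda>z. omega_form + gamma_form (\<gamma> C) z + r C z) (a C) x = 0" if "q_part x \<in> U" for x
      using a CP(1) xin[OF that] unfolding flat_lift_def by blast
  qed (rule U g rf base da r0 a0' low; assumption)+
  have w': "w \<in> fst C" using w by (simp add: C_def)
  then have qw: "q_part (snd C w) \<in> U"
    using Dx[of "snd C w"] by (simp add: chart_image_def)
  show "fps_nth (a (darboux_chart A c) (snd (darboux_chart A c) w) [] N) h = 0" if "h + np N > 0"
  proof -
    have "fib_deg U 0 (\<lambda>x. fps_nth (a C x [] N) h)" using af[of h N] that by simp
    then show ?thesis
      unfolding fib_deg_def polydiff.simps C_def[symmetric] by (subst join_surj) (use qw in blast)
  qed
  show "fps_nth (a (darboux_chart A c) (snd (darboux_chart A c) w) [] {#}) 0 = a0 w"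
    using base_eq[OF qw] a0_fibre[OF qw w' refl] by (simp add: C_def)
qed

theorem mainTheorem10:
  fixes X :: "'m topology"
    and A :: "('m, 'n::finite) chart set"
    and V :: "'m set"
    and \<Gamma> :: "('m, 'n) connection"
    and \<gamma> :: "(('m, 'n) cotangent_point, 'n + 'n) connection"
    and star :: "(('m, 'n) cotangent_point \<Rightarrow> complex) \<Rightarrow> (('m, 'n) cotangent_point \<Rightarrow> complex) \<Rightarrow>
                 ('m, 'n) cotangent_point \<Rightarrow> complex fps"
    and a0 b0 :: "('m, 'n) cotangent_point \<Rightarrow> complex"
    and c :: "('m, 'n) chart"
    and w :: "('m, 'n) cotangent_point"
  assumes "smooth_manifold X A"
    and "linear_connection A \<Gamma>"
    and "torsion_free A \<Gamma>"
    and "symplectic_connection (darboux_atlas A (topspace X)) \<gamma>"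
    and "compatible_connection A \<Gamma> \<gamma>"
    and "openin X V"
    and "fedosov_star_product (darboux_atlas A V) \<gamma> star"
    and "c \<in> A" and "fst c \<subseteq> V"
    and "smooth_function (darboux_atlas A V) a0"
    and "smooth_function (darboux_atlas A V) b0"
    and "depends_only_on_q (darboux_chart A c) a0"
    and "depends_only_on_q (darboux_chart A c) b0"
    and "w \<in> fst (darboux_chart A c)"
  shows "star a0 b0 w = fps_const (a0 w * b0 w)"
proof -
  let ?C = "darboux_chart A c"
  have P: "?C \<in> darboux_atlas A V" using assms by (simp add: darboux_atlas_def)
  have "fst c \<subseteq> topspace X"
    using assms by (simp add: smooth_manifold_def is_chart_def openin_subset)
  then have Q: "?C \<in> darboux_atlas A (topspace X)" using assms by (simp add: darboux_atlas_def)
  \<comment> \<open>The star product is given through some series and some lifts. The weight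
    argument rests on their defining equations and so applies to whichever are obtained
    here.\<close>
  obtain r a b where r: "abelian_connection_series (darboux_atlas A V) \<gamma> r"
    and a: "flat_lift (darboux_atlas A V) \<gamma> r a0 a" and b: "flat_lift (darboux_atlas A V) \<gamma> r b0 b"
    and star: "\<forall>c\<in>darboux_atlas A V. \<forall>w\<in>fst c.
      star a0 b0 w = circ (a c (snd c w)) (b c (snd c w)) [] {#}"
    using assms(7,10,11) unfolding fedosov_star_product_def by blast
  note lift_a = flat_lift_weight_zero[OF assms(1,8,4) Q assms(5) P r a assms(12,14)]
    and lift_b = flat_lift_weight_zero[OF assms(1,8,4) Q assms(5) P r b assms(13,14)]
  have "star a0 b0 w = weyl_mult (a ?C (snd ?C w) []) (b ?C (snd ?C w) []) {#}"
    using star P assms(14) by (simp add: circ_Nil)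
  also have "\<dots> = fps_const (fps_nth (a ?C (snd ?C w) [] {#}) 0 * fps_nth (b ?C (snd ?C w) [] {#}) 0)"
    by (rule weyl_mult_weight_zero) (rule lift_a(1) lift_b(1); assumption)+
  finally show ?thesis
    by (simp only: lift_a(2) lift_b(2))
qed

end
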